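(* Let $a\in(0,1)$ and let $\vec\gamma_s=x_se_1+y_se_2+z_se_3$ be an almost-Riemannian geodesic on $S^2$. If the initial point of the geodesic satisfies $x_0=0$, $y_0=0$ or $z_0=0$, and for some instant of time $\tau>0$ we have $x_\tau=0$, $y_\tau=0$ or $z_\tau=0$ correspondingly (that is, $x_0=x_\tau=0$, or $y_0=y_\tau=0$, or $z_0=z_\tau=0$), then for all $t>\tau$ the geodesic $\vec\gamma_s$, $s\in[0,t]$, is not optimal.
   Context: Fix $a\in(0,1)$. $e_1,e_2,e_3$ is the standard basis of $\mathbb{R}^3$ and $S^2\subset\mathbb{R}^3$ the unit sphere. The almost-Riemannian structure on $S^2$ has orthonormal frame $X_1(\vec\gamma)=\vec\gamma\times e_2$, $X_2(\vec\gamma)=\sqrt{1-a^2}\,\vec\gamma\times e_1$. That is, admissible curves satisfy $\dot{\vec\gamma}=\vec\gamma\times\vec\omega$ with $\vec\omega=u_2\sqrt{1-a^2}\,e_1+u_1e_2$, and one minimizes $\int_0^T\sqrt{u_1^2+u_2^2}\,dt$ with fixed endpoints. A curve is optimal if it realizes this minimum between its endpoints. Geodesics (parameterized by arclength) from $\vec\gamma_0=x_0e_1+y_0e_2+z_0e_3$ are the curves $\vec\gamma_t$ for which there is $p_t=(p_1,p_2,p_3)\in\mathbb{R}^3$ with $$\dot{\vec\gamma}=\vec\gamma\times(p_1e_2+p_2\sqrt{1-a^2}\,e_1),\qquad \dot p_1=p_3p_2,\quad \dot p_2=-p_3p_1,\quad \dot p_3=a^2p_1p_2,\qquad p_1^2+p_2^2=1,$$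 and the transversality condition $p_2(0)x_0+\sqrt{1-a^2}\,p_1(0)y_0+p_3(0)z_0=0$.
   Formalization: In the cases x_0=x_τ=0 and y_0=y_τ=0 the formal theorem also assumes that x (resp. y) is not identically zero along the geodesic; otherwise great circles in the plane x=0 or y=0, whose short arcs are optimal, are counterexamples. *)

theory Defs
  imports "HOL-Analysis.Analysis" "HOL-Analysis.Cross3"
begin

text \<open>The rotation axis \<open>\<omega>\<close> for which \<open>\<gamma> \<times> \<omega> = u1 X1 + u2 X2\<close>, with \<open>X1 = \<gamma> \<times> e2\<close> and
  \<open>X2 = sqrt (1 - a\<^sup>2) (\<gamma> \<times> e1)\<close>.\<close>

definition ar_axis :: "real \<Rightarrow> real \<Rightarrow> real \<Rightarrow> real^3" where
  "ar_axis a u1 u2 = (u2 * sqrt (1 - a\<^sup>2)) *\<^sub>R axis 1 1 + u1 *\<^sub>R axis 2 1"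

text \<open>Controls are measurable and bounded. The equation \<open>\<gamma>' = \<gamma> \<times> \<omega>\<close> is meant almost everywhere
  for an absolutely continuous curve; this is expressed by the equivalent integral equation. That
  equation makes \<open>\<gamma>\<close> continuous, so its integrand is bounded and measurable and the
  Henstock-Kurzweil integral is the Lebesgue integral.\<close>

definition ar_admissible ::
  "real \<Rightarrow> real \<Rightarrow> (real \<Rightarrow> real) \<Rightarrow> (real \<Rightarrow> real) \<Rightarrow> (real \<Rightarrow> real^3) \<Rightarrow> bool" where
  "ar_admissible a T u1 u2 \<gamma> \<longleftrightarrow>
     u1 \<in> borel_measurable (lebesgue_on {0..T}) \<and> bounded (u1 ` {0..T}) \<and>
     u2 \<in> borel_measurable (lebesgue_on {0..T}) \<and> bounded (u2 ` {0..T}) \<and>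
     \<gamma> ` {0..T} \<subseteq> sphere 0 1 \<and>
     (\<forall>t\<in>{0..T}.
        ((\<lambda>s. cross3 (\<gamma> s) (ar_axis a (u1 s) (u2 s))) has_integral (\<gamma> t - \<gamma> 0)) {0..t})"

definition ar_length :: "real \<Rightarrow> (real \<Rightarrow> real) \<Rightarrow> (real \<Rightarrow> real) \<Rightarrow> real" where
  "ar_length T u1 u2 = integral {0..T} (\<lambda>s. sqrt ((u1 s)\<^sup>2 + (u2 s)\<^sup>2))"

text \<open>Optimality of \<open>\<gamma>\<close> restricted to \<open>[0, T]\<close>. The control is existentially quantified because
  the frame is linearly dependent where the third coordinate vanishes, so that a curve need not
  determine its control. Length is invariant under reparameterization, so competitors may be defined
  on any interval \<open>[0, T']\<close>.\<close>

definition ar_optimal :: "real \<Rightarrow> real \<Rightarrow> (real \<Rightarrow> real^3) \<Rightarrow> bool" where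
  "ar_optimal a T \<gamma> \<longleftrightarrow>
     (\<exists>u1 u2. ar_admissible a T u1 u2 \<gamma> \<and>
        (\<forall>T' v1 v2 \<delta>. 0 \<le> T' \<and> ar_admissible a T' v1 v2 \<delta> \<and> \<delta> 0 = \<gamma> 0 \<and> \<delta> T' = \<gamma> T \<longrightarrow>
           ar_length T u1 u2 \<le> ar_length T' v1 v2))"

text \<open>Arclength geodesics, defined for all times \<open>s \<ge> 0\<close>.\<close>

definition ar_geodesic :: "real \<Rightarrow> (real \<Rightarrow> real^3) \<Rightarrow> bool" where
  "ar_geodesic a \<gamma> \<longleftrightarrow>
     \<gamma> 0 \<in> sphere 0 1 \<and>
     (\<exists>p1 p2 p3 :: real \<Rightarrow> real.
        (\<forall>s\<ge>0.
           (\<gamma> has_vector_derivative cross3 (\<gamma> s) (ar_axis a (p1 s) (p2 s))) (at s within {0..}) \<and>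
           (p1 has_real_derivative p3 s * p2 s) (at s within {0..}) \<and>
           (p2 has_real_derivative - (p3 s * p1 s)) (at s within {0..}) \<and>
           (p3 has_real_derivative a\<^sup>2 * p1 s * p2 s) (at s within {0..}) \<and>
           (p1 s)\<^sup>2 + (p2 s)\<^sup>2 = 1) \<and>
        p2 0 * \<gamma> 0 $ 1 + sqrt (1 - a\<^sup>2) * p1 0 * \<gamma> 0 $ 2 + p3 0 * \<gamma> 0 $ 3 = 0)"

text \<open>The great circles in the planes \<open>x = 0\<close> and \<open>y = 0\<close> are geodesics (with \<open>p1 = p3 = 0\<close>,
  respectively \<open>p2 = p3 = 0\<close>). On them the coordinate vanishes at every time although short arcs
  are optimal, so a return to \<open>x = 0\<close> or \<open>y = 0\<close> only bounds the time of optimality if the geodesic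
  is not contained in that plane. No geodesic is contained in \<open>z = 0\<close>.\<close>

end

theory Submission
  imports Defs
begin

text \<open>
  The reflections in the three coordinate planes preserve the almost-Riemannian structure. Suppose that
  the geodesic starts in one of these planes and returns to it at time \<open>\<tau>\<close>. Follow its mirror image up
  to \<open>\<tau>\<close> and then the geodesic itself up to \<open>t\<close>: this concatenation has the same endpoints and the same
  length \<open>t\<close> as the geodesic on \<open>[0, t]\<close>. It is not an extremal, because its momentum jumps at \<open>\<tau>\<close>. For
  the planes \<open>x = 0\<close> and \<open>y = 0\<close> a jump by 0 would mean, by uniqueness for the Hamiltonian system, that
  the geodesic is its own mirror image and lies in the plane
  (\<open>extremal_reflected_momentum_ne\<close>); for \<open>z = 0\<close> the reflection changes the sign of the control
  \<open>(p1, p2)\<close>, which is a unit vector.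

  A jump of the momentum lets the concatenation be shortened near \<open>\<tau>\<close>, and the shortcut from \<open>\<tau> - r\<close>
  to \<open>\<tau> + r\<close> can be written down explicitly for small \<open>r\<close>. There are three kinds of jump.
  If \<open>z \<noteq> 0\<close> at \<open>\<tau>\<close>, the structure is Riemannian there and the concatenation has a corner; a chord cuts it
  (\<open>not_optimal_if_transversal\<close>). If the plane is \<open>z = 0\<close>, the concatenation has a cusp at the singular
  circle; its branches have moved away from the circle by order \<open>r\<close> and from each other by \<open>o(r\<^sup>2)\<close>, so
  a chord between them has length \<open>o(r)\<close> in a metric that grows like \<open>1 / \<bar>z\<bar>\<close>
  (\<open>not_optimal_after_equator\<close>). If the plane is \<open>x = 0\<close> or \<open>y = 0\<close> and \<open>z = 0\<close> at \<open>\<tau>\<close>, the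
  concatenation is differentiable at \<open>\<tau>\<close>, and first-order comparisons of lengths do not see the jump.
  But the geodesic is symmetric about the return point, so the ends of the detour are exact mirror images
  in \<open>z = 0\<close>, and the arc of a circle of constant \<open>x\<close> or \<open>y\<close> between them is shorter: the geodesic spends
  a part of its unit speed of order \<open>r\<^sup>2\<close> on moving across that circle
  (\<open>eventually_arctan_quotient_less\<close>, \<open>not_optimal_after_pole\<close>).

  Shortening the concatenation contradicts optimality only if every control of the geodesic on \<open>[0, t]\<close>
  has length at least \<open>t\<close>. This is shown by calibrating with the momentum covector
  (\<open>extremal_length_le\<close>).
\<close>

section \<open>Extremals in momentum form\<close>

text \<open>A covector at \<open>\<gamma>\<close> is represented by a vector \<open>M\<close> orthogonal to \<open>\<gamma>\<close>, so that \<open>M \<bullet> \<omega>\<close> is its value on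
the velocity \<open>\<gamma> \<times> \<omega>\<close>. Its values on the frame are \<open>p1 = M $ 2\<close> and \<open>p2 = sqrt (1 - a\<^sup>2) * M $ 1\<close>,
and the function below is the rotation axis \<open>ar_axis a p1 p2\<close> of the control \<open>(p1, p2)\<close>. In these
coordinates \<open>\<gamma>\<close> and \<open>M\<close> are carried by the same rotations, and no square root occurs in the
equations.\<close>

definition angular_velocity :: "real \<Rightarrow> real^3 \<Rightarrow> real^3" where
  "angular_velocity a v = vector [(1 - a\<^sup>2) * v $ 1, v $ 2, 0]"

definition ar_extremal :: "real \<Rightarrow> real set \<Rightarrow> (real \<Rightarrow> real^3) \<Rightarrow> (real \<Rightarrow> real^3) \<Rightarrow> bool" where
  "ar_extremal a S \<gamma> M \<longleftrightarrow> (\<forall>s\<in>S.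
     (\<gamma> has_vector_derivative cross3 (\<gamma> s) (angular_velocity a (M s))) (at s within S) \<and>
     (M has_vector_derivative cross3 (M s) (angular_velocity a (M s))) (at s within S) \<and>
     norm (\<gamma> s) = 1 \<and> \<gamma> s \<bullet> M s = 0 \<and> M s \<bullet> angular_velocity a (M s) = 1)"

definition reflect :: "3 \<Rightarrow> real^3 \<Rightarrow> real^3" where
  "reflect k v = (\<chi> i. if i = k then - v $ i else v $ i)"

lemma angular_velocity_nth [simp]:
  "angular_velocity a v $ 1 = (1 - a\<^sup>2) * v $ 1"
  "angular_velocity a v $ 2 = v $ 2"
  "angular_velocity a v $ 3 = 0"
  by (simp_all add: angular_velocity_def)

lemma reflect_nth [simp]: "reflect k v $ i = (if i = k then - v $ i else v $ i)"
  by (simp add: reflect_def)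

lemma reflect_reflect [simp]: "reflect k (reflect k v) = v"
  by (simp add: vec_eq_iff)

lemma norm_vec3: "(norm (v::real^3))\<^sup>2 = (v $ 1)\<^sup>2 + (v $ 2)\<^sup>2 + (v $ 3)\<^sup>2"
  unfolding power2_norm_eq_inner by (simp add: inner_vec_def sum_3 power2_eq_square)

lemma norm_reflect [simp]: "norm (reflect k v) = norm v"
proof -
  have "(norm (reflect k v))\<^sup>2 = (norm v)\<^sup>2"
    by (simp add: norm_vec3 if_distrib[of "\<lambda>x. x\<^sup>2"])
  then show ?thesis by simp
qed

lemma bounded_linear_reflect: "bounded_linear (reflect k)"
  by (rule linear_conv_bounded_linear[THEN iffD1], rule linearI) (simp_all add: vec_eq_iff)

lemma linear_angular_velocity: "linear (angular_velocity a)"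
  by (rule linearI) (simp_all add: vec_eq_iff forall_3 algebra_simps)

lemma angular_velocity_uminus: "angular_velocity a (- v) = - angular_velocity a v"
  by (simp add: vec_eq_iff forall_3)

lemma angular_velocity_reflect: "angular_velocity a (reflect k v) = reflect k (angular_velocity a v)"
  by (simp add: vec_eq_iff forall_3)

lemma cross3_reflect: "cross3 (reflect k v) (reflect k w) = - reflect k (cross3 v w)"
  using exhaust_3[of k] by (auto simp: vec_eq_iff forall_3 cross3_def)

lemma inner_reflect: "reflect k v \<bullet> reflect k w = v \<bullet> w"
  by (simp add: inner_vec_def sum_3)

lemma norm_angular_velocity_le:
  assumes "0 \<le> a" "a \<le> 1"
  shows "norm (angular_velocity a v) \<le> norm v"
proof -
  have "0 \<le> 1 - a\<^sup>2" "1 - a\<^sup>2 \<le> 1"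
    using assms by (auto simp: power_le_one)
  then have "(1 - a\<^sup>2)\<^sup>2 * (v $ 1)\<^sup>2 \<le> 1 * (v $ 1)\<^sup>2"
    by (intro mult_right_mono power_le_one) auto
  then have "(norm (angular_velocity a v))\<^sup>2 \<le> (norm v)\<^sup>2"
    by (simp add: norm_vec3 power_mult_distrib add_increasing2)
  then show ?thesis by (simp add: power2_le_iff_abs_le)
qed

lemma ar_axis_eq_angular_velocity:
  "ar_axis a (M $ 2) (sqrt (1 - a\<^sup>2) * M $ 1) = angular_velocity a M" if "\<bar>a\<bar> \<le> 1"
proof -
  have "sqrt (1 - a\<^sup>2) * sqrt (1 - a\<^sup>2) = 1 - a\<^sup>2"
    using that by (simp add: abs_square_le_1)
  then show ?thesis
    by (simp add: vec_eq_iff forall_3 ar_axis_def axis_def algebra_simps)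
qed

lemma norm_cross3_le: "norm (cross3 v w) \<le> norm v * norm w"
proof -
  have "(norm (cross3 v w))\<^sup>2 \<le> (norm v * norm w)\<^sup>2"
    using norm_cross_dot[of v w] by (smt (verit) zero_le_power2)
  then show ?thesis by (simp add: power2_le_iff_abs_le)
qed

lemma has_real_derivative_inner:
  fixes f g :: "real \<Rightarrow> 'a::real_inner"
  assumes "(f has_vector_derivative f') (at s within S)" "(g has_vector_derivative g') (at s within S)"
  shows "((\<lambda>s. f s \<bullet> g s) has_real_derivative (f s \<bullet> g' + f' \<bullet> g s)) (at s within S)"
  unfolding has_field_derivative_def
  by (rule has_derivative_eq_rhs,
      rule has_derivative_inner[OF assms[unfolded has_vector_derivative_def]])
    (auto simp: fun_eq_iff algebra_simps)

lemma has_real_derivative_norm_square: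
  fixes f :: "real \<Rightarrow> 'a::real_inner"
  assumes "(f has_vector_derivative f') (at s within S)"
  shows "((\<lambda>s. (norm (f s))\<^sup>2) has_real_derivative 2 * (f s \<bullet> f')) (at s within S)"
  using has_real_derivative_inner[OF assms assms] by (simp add: power2_norm_eq_inner inner_commute)

text \<open>The bound is two-sided, so \<open>exp (- C * s) * E s\<close> decreases and \<open>exp (C * s) * E s\<close> increases; the
first controls \<open>E\<close> after its zero and the second before it.\<close>

lemma gronwall_zero:
  fixes E E' :: "real \<Rightarrow> real"
  assumes der: "\<And>s. s \<in> {\<alpha>..\<beta>} \<Longrightarrow> (E has_real_derivative E' s) (at s within {\<alpha>..\<beta>})"
    and bound: "\<And>s. s \<in> {\<alpha>..\<beta>} \<Longrightarrow> \<bar>E' s\<bar> \<le> C * E s"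
    and s0: "s0 \<in> {\<alpha>..\<beta>}" "E s0 = 0" and s: "s \<in> {\<alpha>..\<beta>}" 
  shows "E s \<le> 0"
proof -
  have d: "(E has_real_derivative E' x) (at x)" if "\<alpha> < x" "x < \<beta>" for x
    using der[of x] that by (simp add: at_within_Icc_at)
  have cont: "continuous_on {\<alpha>..\<beta>} E"
    using der by (meson DERIV_continuous_on)
  show ?thesis
  proof (cases "s0 \<le> s")
    case True
    have "exp (- C * s) * E s \<le> exp (- C * s0) * E s0"
    proof (rule DERIV_nonpos_imp_decreasing_open[OF True])
      fix x assume x: "s0 < x" "x < s"
      have "((\<lambda>x. exp (- C * x) * E x) has_real_derivative
          exp (- C * x) * (E' x - C * E x)) (at x)"
        using x s0 s by (auto intro!: derivative_eq_intros d simp: algebra_simps)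
      moreover have "exp (- C * x) * (E' x - C * E x) \<le> 0"
        using bound[of x] x s0 s by (intro mult_nonneg_nonpos) auto
      ultimately show "\<exists>y. ((\<lambda>x. exp (- C * x) * E x) has_real_derivative y) (at x) \<and> y \<le> 0"
        by blast
    next
      show "continuous_on {s0..s} (\<lambda>x. exp (- C * x) * E x)"
        using s0 s by (intro continuous_intros continuous_on_subset[OF cont]) auto
    qed
    then show ?thesis using s0 by (simp add: mult_le_0_iff)
  next
    case False
    then have le: "s \<le> s0" by simp
    have "exp (C * s) * E s \<le> exp (C * s0) * E s0"
    proof (rule DERIV_nonneg_imp_increasing_open[OF le])
      fix x assume x: "s < x" "x < s0"
      have "((\<lambda>x. exp (C * x) * E x) has_real_derivative
          exp (C * x) * (E' x + C * E x)) (at x)"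
        using x s0 s by (auto intro!: derivative_eq_intros d simp: algebra_simps)
      moreover have "exp (C * x) * (E' x + C * E x) \<ge> 0"
        using bound[of x] x s0 s by (intro mult_nonneg_nonneg) auto
      ultimately show "\<exists>y. ((\<lambda>x. exp (C * x) * E x) has_real_derivative y) (at x) \<and> y \<ge> 0"
        by blast
    next
      show "continuous_on {s..s0} (\<lambda>x. exp (C * x) * E x)"
        using s0 s by (intro continuous_intros continuous_on_subset[OF cont]) auto
    qed
    then show ?thesis using s0 by (simp add: mult_le_0_iff)
  qed
qed

lemma ar_extremalD:
  assumes "ar_extremal a S \<gamma> M" "s \<in> S"
  shows "(\<gamma> has_vector_derivative cross3 (\<gamma> s) (angular_velocity a (M s))) (at s within S)"
    and "(M has_vector_derivative cross3 (M s) (angular_velocity a (M s))) (at s within S)"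
    and "norm (\<gamma> s) = 1" and "\<gamma> s \<bullet> M s = 0" and "M s \<bullet> angular_velocity a (M s) = 1"
  using assms unfolding ar_extremal_def by auto

lemma ar_extremal_subset: "ar_extremal a S \<gamma> M \<Longrightarrow> T \<subseteq> S \<Longrightarrow> ar_extremal a T \<gamma> M"
  unfolding ar_extremal_def by (meson has_vector_derivative_within_subset subsetD)

lemma ar_extremal_continuous:
  assumes "ar_extremal a S \<gamma> M"
  shows "continuous_on S \<gamma>" "continuous_on S M"
  using ar_extremalD(1,2)[OF assms]
  by (auto simp: continuous_on_eq_continuous_within intro: has_vector_derivative_continuous)

text \<open>A reflection reverses cross products. The sign in front of the momentum compensates this: it turns
\<open>M\<close> into the axial vector that belongs to the reflected covector. On controls, the reflections in
\<open>x = 0\<close>, \<open>y = 0\<close> and \<open>z = 0\<close> act by \<open>(-p1, p2)\<close>, \<open>(p1, -p2)\<close> and \<open>(-p1, -p2)\<close>, so that they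
preserve length.\<close>

lemma ar_extremal_reflect:
  assumes "ar_extremal a S \<gamma> M"
  shows "ar_extremal a S (\<lambda>s. reflect k (\<gamma> s)) (\<lambda>s. - reflect k (M s))"
  unfolding ar_extremal_def
proof (intro ballI conjI)
  fix s assume s: "s \<in> S"
  note D = ar_extremalD[OF assms s]
  have "((\<lambda>s. reflect k (\<gamma> s)) has_vector_derivative
      reflect k (cross3 (\<gamma> s) (angular_velocity a (M s)))) (at s within S)"
    by (rule bounded_linear.has_vector_derivative[OF bounded_linear_reflect D(1)])
  then show "((\<lambda>s. reflect k (\<gamma> s)) has_vector_derivative
      cross3 (reflect k (\<gamma> s)) (angular_velocity a (- reflect k (M s)))) (at s within S)"
    by (simp add: angular_velocity_uminus angular_velocity_reflect cross3_reflect)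
  have "((\<lambda>s. - reflect k (M s)) has_vector_derivative
      - reflect k (cross3 (M s) (angular_velocity a (M s)))) (at s within S)"
    by (intro has_vector_derivative_minus
        bounded_linear.has_vector_derivative[OF bounded_linear_reflect D(2)])
  then show "((\<lambda>s. - reflect k (M s)) has_vector_derivative
      cross3 (- reflect k (M s)) (angular_velocity a (- reflect k (M s)))) (at s within S)"
    by (simp add: angular_velocity_uminus angular_velocity_reflect cross3_reflect)
qed (use ar_extremalD[OF assms] in
    \<open>auto simp: angular_velocity_uminus angular_velocity_reflect inner_reflect\<close>)

lemma ar_extremal_reverse:
  assumes "ar_extremal a S \<gamma> M"
  shows "ar_extremal a ((\<lambda>s. c - s) ` S) (\<lambda>s. \<gamma> (c - s)) (\<lambda>s. - M (c - s))"
  unfolding ar_extremal_def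
proof (intro ballI conjI)
  fix s assume "s \<in> (\<lambda>s. c - s) ` S"
  then have s: "c - s \<in> S" by auto
  note D = ar_extremalD[OF assms s]
  have im: "(\<lambda>s. c - s) ` (\<lambda>s. c - s) ` S = S" by (force simp: image_image)
  have l: "((\<lambda>s. c - s) has_real_derivative -1) (at s within (\<lambda>s. c - s) ` S)"
    by (auto intro!: derivative_eq_intros)
  have "(\<gamma> \<circ> (\<lambda>s. c - s) has_vector_derivative
      -1 *\<^sub>R cross3 (\<gamma> (c - s)) (angular_velocity a (M (c - s)))) (at s within (\<lambda>s. c - s) ` S)"
    by (rule vector_diff_chain_within
        [OF l[unfolded has_real_derivative_iff_has_vector_derivative]])
      (use D(1) in \<open>simp add: im\<close>)
  then show "((\<lambda>s. \<gamma> (c - s)) has_vector_derivative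
      cross3 (\<gamma> (c - s)) (angular_velocity a (- M (c - s)))) (at s within (\<lambda>s. c - s) ` S)"
    by (simp add: o_def angular_velocity_uminus)
  have "(M \<circ> (\<lambda>s. c - s) has_vector_derivative
      -1 *\<^sub>R cross3 (M (c - s)) (angular_velocity a (M (c - s)))) (at s within (\<lambda>s. c - s) ` S)"
    by (rule vector_diff_chain_within
        [OF l[unfolded has_real_derivative_iff_has_vector_derivative]])
      (use D(2) in \<open>simp add: im\<close>)
  from has_vector_derivative_minus[OF this]
  show "((\<lambda>s. - M (c - s)) has_vector_derivative
      cross3 (- M (c - s)) (angular_velocity a (- M (c - s)))) (at s within (\<lambda>s. c - s) ` S)"
    by (simp add: o_def angular_velocity_uminus)
qed (use ar_extremalD[OF assms] in \<open>auto simp: angular_velocity_uminus\<close>)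

text \<open>In the squared distance of two extremals, the parts of the derivative in which a difference is
multiplied with itself by a cross product vanish; what remains is quadratic in the differences, with
a coefficient bounded by the momentum of one of the two extremals. Gronwall's inequality applies.\<close>

lemma ar_extremal_unique:
  assumes a: "0 \<le> a" "a \<le> 1"
    and e1: "ar_extremal a {\<alpha>..\<beta>} \<gamma> M" and e2: "ar_extremal a {\<alpha>..\<beta>} \<delta> N"
    and s0: "s0 \<in> {\<alpha>..\<beta>}" "\<gamma> s0 = \<delta> s0" "M s0 = N s0" and s: "s \<in> {\<alpha>..\<beta>}"
  shows "\<gamma> s = \<delta> s"
proof -
  let ?A = "angular_velocity a"
  obtain B where B: "\<And>s. s \<in> {\<alpha>..\<beta>} \<Longrightarrow> norm (N s) \<le> B"
    using compact_imp_bounded[OF compact_continuous_image[OF ar_extremal_continuous(2)[OF e2]]]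
    unfolding bounded_iff by (metis compact_Icc imageI)
  have B0: "0 \<le> B" using B[OF s0(1)] norm_ge_zero order_trans by blast
  define E where "E s = (norm (\<gamma> s - \<delta> s))\<^sup>2 + (norm (M s - N s))\<^sup>2" for s
  define E' where "E' s = 2 * ((\<gamma> s - \<delta> s) \<bullet> (cross3 (\<gamma> s) (?A (M s)) - cross3 (\<delta> s) (?A (N s)))) +
      2 * ((M s - N s) \<bullet> (cross3 (M s) (?A (M s)) - cross3 (N s) (?A (N s))))" for s
  have der: "(E has_real_derivative E' s) (at s within {\<alpha>..\<beta>})" if "s \<in> {\<alpha>..\<beta>}" for s
    unfolding E_def E'_def
    by (intro DERIV_add has_real_derivative_norm_square has_vector_derivative_diff
        ar_extremalD(1,2)[OF e1 that] ar_extremalD(1,2)[OF e2 that])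
  have aux: "(v - w) \<bullet> (cross3 v (?A m) - cross3 w (?A n)) = (v - w) \<bullet> cross3 w (?A (m - n))"
    for v w m n
  proof -
    have "cross3 v (?A m) - cross3 w (?A n) = cross3 (v - w) (?A m) + cross3 w (?A (m - n))"
      by (simp add: linear_diff[OF linear_angular_velocity] Cross3.left_diff_distrib
          Cross3.right_diff_distrib)
    then show ?thesis by (simp add: inner_add_right dot_cross_self)
  qed
  have aux2: "\<bar>u \<bullet> cross3 w (?A d)\<bar> \<le> norm u * (norm w * norm d)" for u w d
  proof -
    have "\<bar>u \<bullet> cross3 w (?A d)\<bar> \<le> norm u * norm (cross3 w (?A d))"
      by (rule Cauchy_Schwarz_ineq2)
    also have "\<dots> \<le> norm u * (norm w * norm (?A d))"
      by (intro mult_left_mono norm_cross3_le) auto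
    also have "\<dots> \<le> norm u * (norm w * norm d)"
      by (intro mult_left_mono norm_angular_velocity_le a) auto
    finally show ?thesis .
  qed
  have bound: "\<bar>E' s\<bar> \<le> (1 + 2 * B) * E s" if "s \<in> {\<alpha>..\<beta>}" for s
  proof -
    let ?g = "norm (\<gamma> s - \<delta> s)" and ?m = "norm (M s - N s)"
    have "\<bar>(\<gamma> s - \<delta> s) \<bullet> cross3 (\<delta> s) (?A (M s - N s))\<bar> \<le> ?g * ?m"
      using aux2[of "\<gamma> s - \<delta> s" "\<delta> s" "M s - N s"] ar_extremalD(3)[OF e2 that] by simp
    moreover have "\<bar>(M s - N s) \<bullet> cross3 (N s) (?A (M s - N s))\<bar> \<le> B * ?m\<^sup>2"
    proof -
      have "?m * (norm (N s) * ?m) \<le> ?m * (B * ?m)"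
        by (intro mult_left_mono mult_right_mono B that) auto
      then show ?thesis
        using aux2[of "M s - N s" "N s" "M s - N s"] by (simp add: power2_eq_square mult_ac)
    qed
    ultimately have "\<bar>E' s\<bar> \<le> 2 * (?g * ?m) + 2 * (B * ?m\<^sup>2)"
      unfolding E'_def aux by linarith
    also have "2 * (?g * ?m) \<le> ?g\<^sup>2 + ?m\<^sup>2"
      using zero_le_power2[of "?g - ?m"] by (simp add: power2_diff)
    also have "?g\<^sup>2 + ?m\<^sup>2 + 2 * (B * ?m\<^sup>2) \<le> (1 + 2 * B) * E s"
      unfolding E_def using B0 by (simp add: algebra_simps)
    finally show ?thesis by simp
  qed
  have "E s \<le> 0"
    by (rule gronwall_zero[OF der bound s0(1) _ s]) (use s0 in \<open>auto simp: E_def\<close>)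
  then have "(norm (\<gamma> s - \<delta> s))\<^sup>2 \<le> 0"
    unfolding E_def by (smt (verit) zero_le_power2)
  then show ?thesis by simp
qed

lemma has_vector_derivative_vec3:
  assumes "(f1 has_real_derivative d1) (at s within S)" "(f2 has_real_derivative d2) (at s within S)"
    "(f3 has_real_derivative d3) (at s within S)"
  shows "((\<lambda>s. vector [f1 s, f2 s, f3 s] :: real^3) has_vector_derivative vector [d1, d2, d3])
    (at s within S)"
  unfolding has_vector_derivative_def
  by (rule has_derivative_componentwise_within[THEN iffD2])
    (use assms in \<open>auto simp: Basis_vec_def cart_eq_inner_axis[symmetric] forall_3
      has_field_derivative_def inner_axis mult_commute_abs\<close>)

text \<open>The transversality condition says that \<open>M\<close> is orthogonal to \<open>\<gamma>\<close> at time 0. Because both vectors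
solve the same linear equation \<open>v' = v \<times> \<omega>\<close>, they stay orthogonal.\<close>

lemma geodesic_imp_extremal:
  assumes a: "0 < a" "a < 1" and g: "ar_geodesic a \<gamma>"
  obtains M where "ar_extremal a {0..} \<gamma> M"
proof -
  define c where "c = sqrt (1 - a\<^sup>2)"
  have c2: "c * c = 1 - a\<^sup>2" and c0: "c > 0"
    using a by (auto simp: c_def power_less_one_iff abs_square_less_1 abs_square_le_1)
  obtain p1 p2 p3 where
    dg: "\<And>s. s \<ge> 0 \<Longrightarrow> (\<gamma> has_vector_derivative cross3 (\<gamma> s) (ar_axis a (p1 s) (p2 s))) (at s within {0..})" and
    d1: "\<And>s. s \<ge> 0 \<Longrightarrow> (p1 has_real_derivative p3 s * p2 s) (at s within {0..})" and
    d2: "\<And>s. s \<ge> 0 \<Longrightarrow> (p2 has_real_derivative - (p3 s * p1 s)) (at s within {0..})" and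
    d3: "\<And>s. s \<ge> 0 \<Longrightarrow> (p3 has_real_derivative a\<^sup>2 * p1 s * p2 s) (at s within {0..})" and
    p: "\<And>s. s \<ge> 0 \<Longrightarrow> (p1 s)\<^sup>2 + (p2 s)\<^sup>2 = 1" and
    tr: "p2 0 * \<gamma> 0 $ 1 + c * p1 0 * \<gamma> 0 $ 2 + p3 0 * \<gamma> 0 $ 3 = 0" and
    n0: "norm (\<gamma> 0) = 1"
    using g unfolding ar_geodesic_def c_def by auto
  define M :: "real \<Rightarrow> real^3" where "M s = vector [p2 s / c, p1 s, p3 s / c]" for s
  have ax: "ar_axis a (p1 s) (p2 s) = angular_velocity a (M s)" for s
    using ar_axis_eq_angular_velocity[of a "M s"] a c0 by (simp add: M_def c_def[symmetric])
  have dM: "(M has_vector_derivative cross3 (M s) (angular_velocity a (M s))) (at s within {0..})"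
    if "s \<ge> 0" for s
  proof -
    have "((\<lambda>s. vector [p2 s / c, p1 s, p3 s / c] :: real^3) has_vector_derivative
        vector [- (p3 s * p1 s) / c, p3 s * p2 s, (a\<^sup>2 * p1 s * p2 s) / c]) (at s within {0..})"
      by (intro has_vector_derivative_vec3 DERIV_cdivide d1 d2 d3 that)
    moreover have "vector [- (p3 s * p1 s) / c, p3 s * p2 s, (a\<^sup>2 * p1 s * p2 s) / c] =
        cross3 (M s) (angular_velocity a (M s))"
      using c0 by (simp add: M_def vec_eq_iff forall_3 cross3_def field_simps
          flip: c2) (use c2 in algebra)
    ultimately show ?thesis unfolding M_def by simp
  qed
  have "((\<lambda>s. \<gamma> s \<bullet> \<gamma> s) has_real_derivative 0) (at s within {0..})" if "s \<in> {0..}" for s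
    using has_real_derivative_inner[OF dg dg, of s] that
    by (simp add: dot_cross_self)
  from has_field_derivative_zero_constant[OF convex_real_interval(1) this]
  have n: "norm (\<gamma> s) = 1" if "s \<ge> 0" for s
    using n0 that by (auto simp: norm_eq_1)
  have "((\<lambda>s. \<gamma> s \<bullet> M s) has_real_derivative 0) (at s within {0..})" if "s \<in> {0..}" for s
  proof -
    have "\<gamma> s \<bullet> cross3 (M s) (angular_velocity a (M s)) +
        cross3 (\<gamma> s) (angular_velocity a (M s)) \<bullet> M s = 0"
      by (simp add: cross3_simps)
    then show ?thesis
      using has_real_derivative_inner[OF dg dM, of s] that by (simp add: ax)
  qed
  from has_field_derivative_zero_constant[OF convex_real_interval(1) this]
  obtain K where K: "\<And>s. s \<ge> 0 \<Longrightarrow> \<gamma> s \<bullet> M s = K" by auto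
  have "\<gamma> 0 \<bullet> M 0 = (p2 0 * \<gamma> 0 $ 1 + c * p1 0 * \<gamma> 0 $ 2 + p3 0 * \<gamma> 0 $ 3) / c"
    using c0 by (simp add: M_def inner_vec_def sum_3 field_simps)
  then have "K = 0" using K[of 0] tr by simp
  moreover have "M s \<bullet> angular_velocity a (M s) = 1" if "s \<ge> 0" for s
  proof -
    have "M s \<bullet> angular_velocity a (M s) = (p1 s)\<^sup>2 + (p2 s)\<^sup>2"
      using c0 c2[symmetric] by (simp add: M_def inner_vec_def sum_3 power2_eq_square)
    then show ?thesis using p that by simp
  qed
  ultimately have "ar_extremal a {0..} \<gamma> M"
    unfolding ar_extremal_def using dg dM n K by (auto simp: ax)
  then show ?thesis by (rule that)
qed

section \<open>Controls of an extremal are not shorter than its normal control\<close>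

lemma norm_ar_axis_le:
  assumes "\<bar>a\<bar> \<le> 1"
  shows "norm (ar_axis a u1 u2) \<le> \<bar>u1\<bar> + \<bar>u2\<bar>"
proof -
  have "sqrt (1 - a\<^sup>2) \<le> 1" "0 \<le> sqrt (1 - a\<^sup>2)"
    using assms by (auto simp: abs_square_le_1)
  then have "\<bar>u2\<bar> * sqrt (1 - a\<^sup>2) \<le> \<bar>u2\<bar>"
    by (simp add: mult_left_le)
  moreover have "norm (ar_axis a u1 u2) \<le> \<bar>u2\<bar> * sqrt (1 - a\<^sup>2) + \<bar>u1\<bar>"
    unfolding ar_axis_def using \<open>0 \<le> sqrt (1 - a\<^sup>2)\<close>
    by (intro order_trans[OF norm_triangle_ineq]) (simp add: abs_mult)
  ultimately show ?thesis by simp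
qed

text \<open>The indefinite integral \<open>G\<close> of \<open>h \<bullet> f\<close> has derivative 0: near \<open>s\<close>, replacing \<open>h\<close> by the constant
\<open>h s\<close> costs little because \<open>f\<close> is bounded, and with a constant \<open>h\<close> the integral vanishes. This
avoids the differentiation theorem for indefinite integrals of merely measurable functions.\<close>

lemma has_integral_0_inner_continuous:
  fixes f h :: "real \<Rightarrow> 'a::euclidean_space"
  assumes f: "\<And>s. s \<in> {0..t} \<Longrightarrow> (f has_integral 0) {0..s}"
    and B: "\<And>s. s \<in> {0..t} \<Longrightarrow> norm (f s) \<le> B"
    and cont: "continuous_on {0..t} h" and t: "0 \<le> t"
  shows "((\<lambda>s. h s \<bullet> f s) has_integral 0) {0..t}"
proof -
  have B0: "0 \<le> B" using B[of 0] t norm_ge_zero[of "f 0"] by (simp del: norm_ge_zero)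
  have fi: "f integrable_on {0..t}" using f[of t] t by auto
  have "f absolutely_integrable_on {0..t}"
    by (rule absolutely_integrable_integrable_bound[where g = "\<lambda>_. B"]) (use B fi in auto)
  then have "(\<lambda>s. h s \<bullet> f s) absolutely_integrable_on {0..t}"
    by (intro absolutely_integrable_bounded_measurable_product[where h = "(\<bullet>)"]
        bilinear_conv_bounded_bilinear[THEN iffD2, OF bounded_bilinear_inner]
        continuous_imp_measurable_on_sets_lebesgue[OF cont]
        compact_imp_bounded[OF compact_continuous_image[OF cont compact_Icc]]) simp_all
  then have int: "(\<lambda>s. h s \<bullet> f s) integrable_on {0..t}"
    by (rule set_lebesgue_integral_eq_integral)
  define G where "G s = integral {0..s} (\<lambda>s. h s \<bullet> f s)" for s
  have der: "(G has_real_derivative 0) (at s within {0..t})" if s: "s \<in> {0..t}" for s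
    unfolding has_field_derivative_def has_derivative_within_alt
  proof (intro conjI allI impI)
    fix e :: real assume e: "0 < e"
    then have "0 < e / (B + 1)" using B0 by simp
    then obtain d where d: "d > 0"
      "\<And>x. x \<in> {0..t} \<Longrightarrow> dist x s < d \<Longrightarrow> dist (h x) (h s) < e / (B + 1)"
      using cont s unfolding continuous_on_iff by metis
    have key: "\<bar>G y - G x\<bar> \<le> e * (y - x)"
      if xy: "x \<le> y" "x \<in> {0..t}" "y \<in> {0..t}" "\<bar>x - s\<bar> < d" "\<bar>y - s\<bar> < d" for x y
    proof -
      have sub: "(\<lambda>s. h s \<bullet> f s) integrable_on {0..y}" "(\<lambda>s. h s \<bullet> f s) integrable_on {x..y}"
        using xy by (auto intro: integrable_subinterval_real[OF int])
      have "G y - G x = integral {x..y} (\<lambda>s. h s \<bullet> f s)"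
        unfolding G_def
        using Henstock_Kurzweil_Integration.integral_combine[OF _ xy(1) sub(1)] xy by simp
      moreover have "((\<lambda>r. h s \<bullet> f r) has_integral 0) {x..y}"
      proof -
        have i: "f integrable_on {0..y}" using f[OF xy(3)] by auto
        have "integral {x..y} f = 0"
          using Henstock_Kurzweil_Integration.integral_combine[OF _ xy(1) i]
            f[OF xy(2)] f[OF xy(3)] xy by (simp add: integral_unique)
        then have "(f has_integral 0) {x..y}"
          using integrable_subinterval_real[OF i, of x y] xy
          by (auto simp: has_integral_integral)
        from has_integral_linear[OF this bounded_linear_inner_right[of "h s"]]
        show ?thesis by (simp add: o_def)
      qed
      ultimately have "((\<lambda>r. h r \<bullet> f r - h s \<bullet> f r) has_integral (G y - G x - 0)) {x..y}"
        using sub(2) by (intro has_integral_diff) (auto simp: has_integral_integral)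
      moreover have "norm (h r \<bullet> f r - h s \<bullet> f r) \<le> e" if r: "r \<in> {x..y}" for r
      proof -
        have "norm (h r \<bullet> f r - h s \<bullet> f r) \<le> norm (h r - h s) * norm (f r)"
          by (metis Cauchy_Schwarz_ineq2 inner_diff_left real_norm_def)
        also have "\<dots> \<le> e / (B + 1) * B"
        proof (rule mult_mono)
          show "norm (h r - h s) \<le> e / (B + 1)"
            using d(2)[of r] r xy by (auto simp: dist_norm intro!: less_imp_le)
        qed (use r xy B e B0 in auto)
        also have "\<dots> \<le> e"
          using e B0 by (simp add: field_simps)
        finally show ?thesis .
      qed
      ultimately have "norm (G y - G x - 0) \<le> e * measure lborel (cbox x y)"
        using e by (intro has_integral_bound[where f = "\<lambda>r. h r \<bullet> f r - h s \<bullet> f r"]) auto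
      then show ?thesis using xy by simp
    qed
    have "norm (G y - G s - 0 * (y - s)) \<le> e * norm (y - s)" if "y \<in> {0..t}" "norm (y - s) < d" for y
      using key[of y s] key[of s y] that s d(1) by (cases "y \<le> s") (auto simp: abs_minus_commute)
    then show "\<exists>d>0. \<forall>y\<in>{0..t}. norm (y - s) < d \<longrightarrow>
        norm (G y - G s - 0 * (y - s)) \<le> e * norm (y - s)"
      using d(1) by blast
  qed (rule bounded_linear_mult_right)
  have "G t = G 0"
    using has_field_derivative_zero_constant[OF convex_real_interval(5) der] t by force
  also have "G 0 = 0" by (simp add: G_def)
  finally show ?thesis using int unfolding G_def by (simp add: has_integral_iff)
qed

text \<open>On the singular circle \<open>z = 0\<close> a velocity does not determine its control, so a different control
could conceivably give the same curve a smaller length. It does not: pairing the velocity with the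
covector \<open>\<gamma> \<times> M\<close> gives \<open>p1 u1 + p2 u2\<close> for any control \<open>u\<close> of the curve and \<open>p1\<^sup>2 + p2\<^sup>2 = 1\<close> for
the normal control. Both have the same integral, and \<open>p1 u1 + p2 u2\<close> is at most the norm of \<open>u\<close>.\<close>

lemma extremal_length_le:
  assumes a: "0 \<le> a" "a \<le> 1" and e: "ar_extremal a {0..t} \<gamma> M" and t: "0 \<le> t"
    and adm: "ar_admissible a t u1 u2 \<gamma>"
  shows "t \<le> ar_length t u1 u2"
proof -
  define c where "c = sqrt (1 - a\<^sup>2)"
  let ?w = "\<lambda>s. ar_axis a (u1 s) (u2 s)"
  define f where "f s = cross3 (\<gamma> s) (?w s) - cross3 (\<gamma> s) (angular_velocity a (M s))" for s
  define h where "h s = cross3 (\<gamma> s) (M s)" for s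
  note ad = adm[unfolded ar_admissible_def]
  note contM = ar_extremal_continuous[OF e]
  have contL: "continuous_on {0..t} h"
    unfolding h_def by (intro continuous_on_cross contM)
  obtain B1 where B1: "\<And>s. s \<in> {0..t} \<Longrightarrow> \<bar>u1 s\<bar> \<le> B1"
    using ad unfolding bounded_iff by (metis imageI real_norm_def)
  obtain B2 where B2: "\<And>s. s \<in> {0..t} \<Longrightarrow> \<bar>u2 s\<bar> \<le> B2"
    using ad unfolding bounded_iff by (metis imageI real_norm_def)
  obtain B where B: "\<And>s. s \<in> {0..t} \<Longrightarrow> norm (M s) \<le> B"
    using compact_imp_bounded[OF compact_continuous_image[OF contM(2)]]
    unfolding bounded_iff by (metis compact_Icc imageI)
  have fB: "norm (f s) \<le> B1 + B2 + B" if s: "s \<in> {0..t}" for s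
  proof -
    have "norm (f s) \<le> norm (?w s) + norm (angular_velocity a (M s))"
      unfolding f_def using norm_cross3_le[of "\<gamma> s"] ar_extremalD(3)[OF e s]
      by (intro order_trans[OF norm_triangle_ineq4]) (simp add: add_mono)
    then show ?thesis
      using norm_ar_axis_le[of a "u1 s" "u2 s"] norm_angular_velocity_le[OF a, of "M s"]
        B1[OF s] B2[OF s] B[OF s] a by linarith
  qed
  \<comment> \<open>both integrands have the indefinite integral \<open>\<gamma> s - \<gamma> 0\<close>\<close>
  have f0: "(f has_integral 0) {0..s}" if s: "s \<in> {0..t}" for s
  proof -
    have "((\<lambda>s. cross3 (\<gamma> s) (angular_velocity a (M s))) has_integral (\<gamma> s - \<gamma> 0)) {0..s}"
      using s by (intro fundamental_theorem_of_calculus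
          ar_extremalD(1)[OF ar_extremal_subset[OF e]]) auto
    then show ?thesis
      unfolding f_def using ad s has_integral_diff[of _ "\<gamma> s - \<gamma> 0" "{0..s}" _ "\<gamma> s - \<gamma> 0"]
      by simp
  qed
  have scal: "h s \<bullet> f s = M s \<bullet> ?w s - 1" if s: "s \<in> {0..t}" for s
  proof -
    have "h s \<bullet> cross3 (\<gamma> s) w = (\<gamma> s \<bullet> \<gamma> s) * (M s \<bullet> w) - (\<gamma> s \<bullet> w) * (\<gamma> s \<bullet> M s)" for w
      unfolding h_def by (simp add: cross3_simps)
    then show ?thesis
      unfolding f_def inner_diff_right using ar_extremalD(3-5)[OF e s]
      by (simp add: norm_eq_1)
  qed
  have "((\<lambda>s. h s \<bullet> f s) has_integral 0) {0..t}"
    by (rule has_integral_0_inner_continuous[OF f0 fB contL t])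
  then have "((\<lambda>s. M s \<bullet> ?w s - 1) has_integral 0) {0..t}"
    by (rule has_integral_eq[rotated]) (rule scal)
  from has_integral_add[OF this has_integral_const_real[of 1 0 t]]
  have i1: "((\<lambda>s. M s \<bullet> ?w s) has_integral t) {0..t}" using t by simp
  have le: "M s \<bullet> ?w s \<le> sqrt ((u1 s)\<^sup>2 + (u2 s)\<^sup>2)" if s: "s \<in> {0..t}" for s
  proof -
    have c2: "c * c = 1 - a\<^sup>2"
      using a by (auto simp: c_def abs_square_le_1)
    let ?p = "c * M s $ 1" and ?q = "M s $ 2"
    have "M s \<bullet> ?w s = ?q * u1 s + ?p * u2 s"
      by (simp add: ar_axis_def inner_vec_def sum_3 c_def[symmetric] axis_def algebra_simps)
    also have "\<dots> \<le> \<bar>?q * u1 s + ?p * u2 s\<bar>" by simp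
    also have "\<dots> \<le> sqrt (?q\<^sup>2 + ?p\<^sup>2) * sqrt ((u1 s)\<^sup>2 + (u2 s)\<^sup>2)"
      using Cauchy_Schwarz_ineq2[of "(?q, ?p)" "(u1 s, u2 s)"] by (simp add: norm_Pair)
    also have "?q\<^sup>2 + ?p\<^sup>2 = 1"
    proof -
      have "(1 - a\<^sup>2) * (M s $ 1)\<^sup>2 + (M s $ 2)\<^sup>2 = 1"
        using ar_extremalD(5)[OF e s] by (simp add: inner_vec_def sum_3 power2_eq_square mult_ac)
      then show ?thesis unfolding c2[symmetric] by (simp add: power2_eq_square algebra_simps)
    qed
    finally show ?thesis by simp
  qed
  have "(\<lambda>s. sqrt ((u1 s)\<^sup>2 + (u2 s)\<^sup>2)) absolutely_integrable_on {0..t}"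
  proof (rule measurable_bounded_by_integrable_imp_absolutely_integrable)
    show "(\<lambda>s. sqrt ((u1 s)\<^sup>2 + (u2 s)\<^sup>2)) \<in> borel_measurable (lebesgue_on {0..t})"
    proof -
      have [measurable]: "u1 \<in> borel_measurable (lebesgue_on {0..t})"
        "u2 \<in> borel_measurable (lebesgue_on {0..t})"
        using ad by auto
      show ?thesis by measurable
    qed
    show "norm (sqrt ((u1 s)\<^sup>2 + (u2 s)\<^sup>2)) \<le> B1 + B2" if "s \<in> {0..t}" for s
      using sqrt_sum_squares_le_sum_abs[of "u1 s" "u2 s"] B1[OF that] B2[OF that] by simp
  qed auto
  then have i2: "(\<lambda>s. sqrt ((u1 s)\<^sup>2 + (u2 s)\<^sup>2)) integrable_on {0..t}"
    by (rule set_lebesgue_integral_eq_integral)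
  show ?thesis
    unfolding ar_length_def
    by (rule has_integral_le[OF i1 integrable_integral[OF i2] le])
qed

section \<open>Concatenation of admissible curves\<close>

text \<open>Existence of a control of length at most \<open>L\<close> on \<open>{\<alpha>..\<beta>}\<close>. Borel functions on the whole line are
used as controls because these can be concatenated by a case distinction.\<close>

definition ar_path :: "real \<Rightarrow> real \<Rightarrow> real \<Rightarrow> real \<Rightarrow> (real \<Rightarrow> real^3) \<Rightarrow> bool" where
  "ar_path a \<alpha> \<beta> L \<gamma> \<longleftrightarrow> (\<exists>u1 u2 l.
     u1 \<in> borel_measurable borel \<and> bounded (range u1) \<and>
     u2 \<in> borel_measurable borel \<and> bounded (range u2) \<and>
     \<gamma> ` {\<alpha>..\<beta>} \<subseteq> sphere 0 1 \<and>
     (\<forall>t\<in>{\<alpha>..\<beta>}.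
        ((\<lambda>s. cross3 (\<gamma> s) (ar_axis a (u1 s) (u2 s))) has_integral (\<gamma> t - \<gamma> \<alpha>)) {\<alpha>..t}) \<and>
     ((\<lambda>s. sqrt ((u1 s)\<^sup>2 + (u2 s)\<^sup>2)) has_integral l) {\<alpha>..\<beta>} \<and> l \<le> L)"

lemma ar_path_smooth:
  assumes le: "\<alpha> \<le> \<beta>"
    and der: "\<And>s. s \<in> {\<alpha>..\<beta>} \<Longrightarrow>
      (\<gamma> has_vector_derivative cross3 (\<gamma> s) (ar_axis a (u1 s) (u2 s))) (at s within {\<alpha>..\<beta>})"
    and norm: "\<And>s. s \<in> {\<alpha>..\<beta>} \<Longrightarrow> norm (\<gamma> s) = 1"
    and cont: "continuous_on {\<alpha>..\<beta>} u1" "continuous_on {\<alpha>..\<beta>} u2"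
    and bound: "\<And>s. s \<in> {\<alpha>..\<beta>} \<Longrightarrow> sqrt ((u1 s)\<^sup>2 + (u2 s)\<^sup>2) \<le> v"
  shows "ar_path a \<alpha> \<beta> ((\<beta> - \<alpha>) * v) \<gamma>"
proof -
  \<comment> \<open>extension by 0, which is Borel on the whole line\<close>
  define e :: "(real \<Rightarrow> real) \<Rightarrow> real \<Rightarrow> real" where "e u s = (if s \<in> {\<alpha>..\<beta>} then u s else 0)" for u s
  have e_meas: "e u \<in> borel_measurable borel" if "continuous_on {\<alpha>..\<beta>} u" for u
    unfolding e_def by (intro borel_measurable_continuous_on_if that) auto
  have e_bdd: "bounded (range (e u))" if "continuous_on {\<alpha>..\<beta>} u" for u
  proof (rule bounded_subset)
    show "bounded (insert 0 (u ` {\<alpha>..\<beta>}))"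
      using compact_imp_bounded[OF compact_continuous_image[OF that compact_Icc]] by simp
    show "range (e u) \<subseteq> insert 0 (u ` {\<alpha>..\<beta>})"
      by (auto simp: e_def)
  qed
  have int: "((\<lambda>s. cross3 (\<gamma> s) (ar_axis a (e u1 s) (e u2 s))) has_integral (\<gamma> t - \<gamma> \<alpha>)) {\<alpha>..t}"
    if t: "t \<in> {\<alpha>..\<beta>}" for t
  proof (rule has_integral_eq)
    show "((\<lambda>s. cross3 (\<gamma> s) (ar_axis a (u1 s) (u2 s))) has_integral (\<gamma> t - \<gamma> \<alpha>)) {\<alpha>..t}"
      using t by (intro fundamental_theorem_of_calculus
          has_vector_derivative_within_subset[OF der]) auto
  qed (use t in \<open>auto simp: e_def\<close>)
  have "(\<lambda>s. sqrt ((u1 s)\<^sup>2 + (u2 s)\<^sup>2)) integrable_on {\<alpha>..\<beta>}"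
    by (intro integrable_continuous_real continuous_intros cont)
  then obtain l where l: "((\<lambda>s. sqrt ((u1 s)\<^sup>2 + (u2 s)\<^sup>2)) has_integral l) {\<alpha>..\<beta>}"
    by auto
  then have l': "((\<lambda>s. sqrt ((e u1 s)\<^sup>2 + (e u2 s)\<^sup>2)) has_integral l) {\<alpha>..\<beta>}"
    by (rule has_integral_eq[rotated]) (simp add: e_def)
  have "l \<le> (\<beta> - \<alpha>) * v"
    using has_integral_le[OF l has_integral_const_real[of v \<alpha> \<beta>] bound] le by simp
  then show ?thesis
    unfolding ar_path_def
    using norm cont by (intro exI[of _ "e u1"] exI[of _ "e u2"] exI[of _ l] conjI ballI e_meas e_bdd int l') auto
qed

lemma ar_path_join:
  assumes le: "\<alpha> \<le> \<beta>" "\<beta> \<le> \<kappa>" and p: "ar_path a \<alpha> \<beta> K \<gamma>" and q: "ar_path a \<beta> \<kappa> L \<delta>"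
    and eq: "\<gamma> \<beta> = \<delta> \<beta>"
  shows "ar_path a \<alpha> \<kappa> (K + L) (\<lambda>s. if s \<le> \<beta> then \<gamma> s else \<delta> s)"
proof -
  from p obtain u1 u2 k where
    mu: "u1 \<in> borel_measurable borel" "u2 \<in> borel_measurable borel" and
    bu: "bounded (range u1)" "bounded (range u2)" and
    su: "\<gamma> ` {\<alpha>..\<beta>} \<subseteq> sphere 0 1" and
    iu: "\<And>t. t \<in> {\<alpha>..\<beta>} \<Longrightarrow>
      ((\<lambda>s. cross3 (\<gamma> s) (ar_axis a (u1 s) (u2 s))) has_integral (\<gamma> t - \<gamma> \<alpha>)) {\<alpha>..t}" and
    ku: "((\<lambda>s. sqrt ((u1 s)\<^sup>2 + (u2 s)\<^sup>2)) has_integral k) {\<alpha>..\<beta>}" "k \<le> K"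
    unfolding ar_path_def by blast
  from q obtain v1 v2 l where
    mv: "v1 \<in> borel_measurable borel" "v2 \<in> borel_measurable borel" and
    bv: "bounded (range v1)" "bounded (range v2)" and
    sv: "\<delta> ` {\<beta>..\<kappa>} \<subseteq> sphere 0 1" and
    iv: "\<And>t. t \<in> {\<beta>..\<kappa>} \<Longrightarrow>
      ((\<lambda>s. cross3 (\<delta> s) (ar_axis a (v1 s) (v2 s))) has_integral (\<delta> t - \<delta> \<beta>)) {\<beta>..t}" and
    lv: "((\<lambda>s. sqrt ((v1 s)\<^sup>2 + (v2 s)\<^sup>2)) has_integral l) {\<beta>..\<kappa>}" "l \<le> L"
    unfolding ar_path_def by blast
  define g where "g s = (if s \<le> \<beta> then \<gamma> s else \<delta> s)" for s
  define w1 where "w1 s = (if s \<le> \<beta> then u1 s else v1 s)" for s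
  define w2 where "w2 s = (if s \<le> \<beta> then u2 s else v2 s)" for s
  have mw: "w1 \<in> borel_measurable borel" "w2 \<in> borel_measurable borel"
    unfolding w1_def w2_def using mu mv by measurable
  have bw: "bounded (range w1)" "bounded (range w2)"
    by (rule bounded_subset[OF bounded_Un[THEN iffD2, OF conjI[OF bu(1) bv(1)]]], force simp: w1_def,
        rule bounded_subset[OF bounded_Un[THEN iffD2, OF conjI[OF bu(2) bv(2)]]], force simp: w2_def)
  have sw: "g ` {\<alpha>..\<kappa>} \<subseteq> sphere 0 1"
    using su sv by (auto simp: g_def image_subset_iff)
  have i1: "((\<lambda>s. cross3 (g s) (ar_axis a (w1 s) (w2 s))) has_integral (g t - g \<alpha>)) {\<alpha>..t}"
    if "t \<in> {\<alpha>..\<beta>}" for t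
  proof -
    have "g t - g \<alpha> = \<gamma> t - \<gamma> \<alpha>" using le that by (simp add: g_def)
    moreover have "((\<lambda>s. cross3 (g s) (ar_axis a (w1 s) (w2 s))) has_integral (\<gamma> t - \<gamma> \<alpha>)) {\<alpha>..t}"
      using iu[OF that] by (rule has_integral_eq[rotated]) (use that in \<open>simp add: g_def w1_def w2_def\<close>)
    ultimately show ?thesis by simp
  qed
  have i2: "((\<lambda>s. cross3 (g s) (ar_axis a (w1 s) (w2 s))) has_integral (g t - g \<beta>)) {\<beta>..t}"
    if "t \<in> {\<beta>..\<kappa>}" for t
  proof -
    have "g t - g \<beta> = \<delta> t - \<delta> \<beta>" using that eq by (auto simp: g_def)
    then show ?thesis
      using has_integral_spike_finite[OF finite.insertI[OF finite.emptyI, of \<beta>] _ iv[OF that]]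
      by (simp add: g_def w1_def w2_def)
  qed
  have iw: "((\<lambda>s. cross3 (g s) (ar_axis a (w1 s) (w2 s))) has_integral (g t - g \<alpha>)) {\<alpha>..t}"
    if "t \<in> {\<alpha>..\<kappa>}" for t
  proof (cases "t \<le> \<beta>")
    case False
    then show ?thesis
      using has_integral_combine[OF le(1) _ i1[of \<beta>] i2[of t]] le that by simp
  qed (use i1 that in auto)
  have "((\<lambda>s. sqrt ((w1 s)\<^sup>2 + (w2 s)\<^sup>2)) has_integral k) {\<alpha>..\<beta>}"
    using ku(1) by (rule has_integral_eq[rotated]) (simp add: w1_def w2_def)
  moreover have "((\<lambda>s. sqrt ((w1 s)\<^sup>2 + (w2 s)\<^sup>2)) has_integral l) {\<beta>..\<kappa>}"
    using has_integral_spike_finite[OF finite.insertI[OF finite.emptyI, of \<beta>] _ lv(1)]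
    by (simp add: w1_def w2_def)
  ultimately have "((\<lambda>s. sqrt ((w1 s)\<^sup>2 + (w2 s)\<^sup>2)) has_integral (k + l)) {\<alpha>..\<kappa>}"
    by (rule has_integral_combine[OF le])
  then have "ar_path a \<alpha> \<kappa> (K + L) g"
    unfolding ar_path_def using mw bw sw iw ku(2) lv(2)
    by (intro exI[of _ w1] exI[of _ w2] exI[of _ "k + l"]) auto
  then show ?thesis unfolding g_def .
qed

lemma extremal_ar_path:
  assumes a: "0 \<le> a" "a \<le> 1" and e: "ar_extremal a {\<alpha>..\<beta>} \<gamma> M" and le: "\<alpha> \<le> \<beta>"
  shows "ar_path a \<alpha> \<beta> (\<beta> - \<alpha>) \<gamma>"
proof -
  have "ar_path a \<alpha> \<beta> ((\<beta> - \<alpha>) * 1) \<gamma>"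
  proof (rule ar_path_smooth[OF le])
    fix s assume s: "s \<in> {\<alpha>..\<beta>}"
    show "(\<gamma> has_vector_derivative
        cross3 (\<gamma> s) (ar_axis a (M s $ 2) (sqrt (1 - a\<^sup>2) * M s $ 1))) (at s within {\<alpha>..\<beta>})"
      using ar_extremalD(1)[OF e s] a by (simp add: ar_axis_eq_angular_velocity)
    have "sqrt (1 - a\<^sup>2) * sqrt (1 - a\<^sup>2) = 1 - a\<^sup>2"
      using a by (simp add: abs_square_le_1)
    then show "sqrt ((M s $ 2)\<^sup>2 + (sqrt (1 - a\<^sup>2) * M s $ 1)\<^sup>2) \<le> 1"
      using ar_extremalD(5)[OF e s]
      by (simp add: inner_vec_def sum_3 power_mult_distrib) (simp add: power2_eq_square algebra_simps)
  qed (intro continuous_intros ar_extremal_continuous[OF e] ar_extremalD(3)[OF e] | assumption)+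
  then show ?thesis by simp
qed

lemma optimal_extremal_le:
  assumes a: "0 \<le> a" "a \<le> 1" and e: "ar_extremal a {0..t} \<gamma> M" and t: "0 \<le> t"
    and opt: "ar_optimal a t \<gamma>"
    and p: "ar_path a 0 t L \<delta>" and ends: "\<delta> 0 = \<gamma> 0" "\<delta> t = \<gamma> t"
  shows "t \<le> L"
proof -
  from opt obtain u1 u2 where adm: "ar_admissible a t u1 u2 \<gamma>" and
    min: "\<And>T' v1 v2 \<delta>. 0 \<le> T' \<Longrightarrow> ar_admissible a T' v1 v2 \<delta> \<Longrightarrow> \<delta> 0 = \<gamma> 0 \<Longrightarrow> \<delta> T' = \<gamma> t \<Longrightarrow>
           ar_length t u1 u2 \<le> ar_length T' v1 v2"
    unfolding ar_optimal_def by blast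
  from p obtain v1 v2 l where v: "v1 \<in> borel_measurable borel" "bounded (range v1)"
     "v2 \<in> borel_measurable borel" "bounded (range v2)"
     "\<delta> ` {0..t} \<subseteq> sphere 0 1"
     "\<forall>t\<in>{0..t}.
        ((\<lambda>s. cross3 (\<delta> s) (ar_axis a (v1 s) (v2 s))) has_integral (\<delta> t - \<delta> 0)) {0..t}"
     "((\<lambda>s. sqrt ((v1 s)\<^sup>2 + (v2 s)\<^sup>2)) has_integral l) {0..t}" "l \<le> L"
    unfolding ar_path_def by blast
  have meas: "v \<in> borel_measurable (lebesgue_on {0..t})" if "v \<in> borel_measurable borel" for v :: "real \<Rightarrow> real"
    using that by (simp add: measurable_completion measurable_restrict_space1)
  have "ar_admissible a t v1 v2 \<delta>"
    unfolding ar_admissible_def using v by (auto intro: meas elim: bounded_subset)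
  with min ends t have "ar_length t u1 u2 \<le> ar_length t v1 v2" by blast
  also have "\<dots> = l" unfolding ar_length_def using v(7) by (rule integral_unique)
  finally show ?thesis
    using extremal_length_le[OF a e t adm] v(8) by linarith
qed

text \<open>The competitor follows the reflected geodesic up to \<open>\<tau> - r\<close>, then \<open>\<eta>\<close>, and then the geodesic itself
from \<open>\<tau> + r\<close> on.\<close>

lemma not_optimal_if_shortcut:
  assumes a: "0 \<le> a" "a \<le> 1" and e: "ar_extremal a {0..t} \<gamma> M"
    and r: "0 < r" "r \<le> \<tau>" "\<tau> + r \<le> t" and k: "reflect k (\<gamma> 0) = \<gamma> 0"
    and p: "ar_path a (\<tau> - r) (\<tau> + r) L \<eta>" "L < 2 * r"
    and ends: "\<eta> (\<tau> - r) = reflect k (\<gamma> (\<tau> - r))" "\<eta> (\<tau> + r) = \<gamma> (\<tau> + r)"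
  shows "\<not> ar_optimal a t \<gamma>"
proof
  assume opt: "ar_optimal a t \<gamma>"
  define \<delta> where "\<delta> s = (if s \<le> \<tau> + r then if s \<le> \<tau> - r then reflect k (\<gamma> s) else \<eta> s else \<gamma> s)" for s
  have "ar_path a 0 (\<tau> - r) (\<tau> - r - 0) (\<lambda>s. reflect k (\<gamma> s))"
    using r by (intro extremal_ar_path[OF a ar_extremal_reflect[OF ar_extremal_subset[OF e]]]) auto
  from ar_path_join[OF _ _ this p(1)]
  have *: "ar_path a 0 (\<tau> + r) (\<tau> - r + L) (\<lambda>s. if s \<le> \<tau> - r then reflect k (\<gamma> s) else \<eta> s)"
    using r ends by simp
  have "ar_path a (\<tau> + r) t (t - (\<tau> + r)) \<gamma>"
    using r by (intro extremal_ar_path[OF a ar_extremal_subset[OF e]]) auto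
  from ar_path_join[OF _ _ * this]
  have "ar_path a 0 t (\<tau> - r + L + (t - (\<tau> + r))) \<delta>"
    using r ends unfolding \<delta>_def by simp
  moreover have "\<delta> 0 = \<gamma> 0" "\<delta> t = \<gamma> t"
    using r k ends by (auto simp: \<delta>_def)
  ultimately have "t \<le> \<tau> - r + L + (t - (\<tau> + r))"
    using r by (intro optimal_extremal_le[OF a e _ opt, of _ \<delta>]) auto
  then show False using p(2) by linarith
qed

section \<open>Chords and arcs\<close>

text \<open>Where \<open>z\<close> does not vanish, \<open>x\<close> and \<open>y\<close> are coordinates in which the squared length element is
\<open>(dx\<^sup>2 + dy\<^sup>2 / (1 - a\<^sup>2)) / z\<^sup>2\<close>. The path is a straight segment in these coordinates; \<open>x\<^sup>2 + y\<^sup>2\<close> is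
convex along it, so \<open>\<bar>z\<bar>\<close> stays above its bound \<open>m\<close> at the two ends. The sign \<open>\<sigma>\<close> selects the
hemisphere.\<close>

lemma chord_path:
  assumes a: "0 \<le> a" "a < 1" and le: "\<alpha> < \<beta>" and m: "0 < m"
    and A: "norm A = 1" "m \<le> \<sigma> * A $ 3" and B: "norm B = 1" "m \<le> \<sigma> * B $ 3" and \<sigma>: "\<bar>\<sigma>\<bar> = 1"
  obtains \<eta> where "\<eta> \<alpha> = A" "\<eta> \<beta> = B"
    "ar_path a \<alpha> \<beta> (sqrt ((B $ 1 - A $ 1)\<^sup>2 + (B $ 2 - A $ 2)\<^sup>2 / (1 - a\<^sup>2)) / m) \<eta>"
proof -
  define c where "c = sqrt (1 - a\<^sup>2)"
  have c: "c > 0" "c\<^sup>2 = 1 - a\<^sup>2"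
    using a by (auto simp: c_def abs_square_less_1 abs_square_le_1)
  have \<sigma>2: "\<sigma>\<^sup>2 = 1" using \<sigma> by (metis power2_abs power_one)
  define X' where "X' = (B $ 1 - A $ 1) / (\<beta> - \<alpha>)"
  define Y' where "Y' = (B $ 2 - A $ 2) / (\<beta> - \<alpha>)"
  define X where "X s = A $ 1 + (s - \<alpha>) * X'" for s
  define Y where "Y s = A $ 2 + (s - \<alpha>) * Y'" for s
  define q where "q s = 1 - (X s)\<^sup>2 - (Y s)\<^sup>2" for s
  define Z where "Z s = \<sigma> * sqrt (q s)" for s
  have sA: "(A $ 3)\<^sup>2 = 1 - (A $ 1)\<^sup>2 - (A $ 2)\<^sup>2" "(B $ 3)\<^sup>2 = 1 - (B $ 1)\<^sup>2 - (B $ 2)\<^sup>2"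
    using norm_vec3[of A] norm_vec3[of B] A B by auto
  have m2: "m\<^sup>2 \<le> (A $ 3)\<^sup>2" "m\<^sup>2 \<le> (B $ 3)\<^sup>2"
    using power_mono[OF A(2), of 2] power_mono[OF B(2), of 2] m \<sigma>2 by (auto simp: power_mult_distrib)
  have ends: "X \<alpha> = A $ 1" "Y \<alpha> = A $ 2" "X \<beta> = B $ 1" "Y \<beta> = B $ 2"
    using le by (auto simp: X_def Y_def X'_def Y'_def)
  have root: "\<sigma> * sqrt ((v::real)\<^sup>2) = v" if "m \<le> \<sigma> * v" for v
    using that m \<sigma> by (cases "\<sigma> \<ge> 0") (auto simp: abs_if mult_less_0_iff split: if_splits)
  have endZ: "Z \<alpha> = A $ 3" "Z \<beta> = B $ 3"
    using root[OF A(2)] root[OF B(2)] sA ends by (auto simp: Z_def q_def)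
  have qm: "m\<^sup>2 \<le> q s" if s: "s \<in> {\<alpha>..\<beta>}" for s
  proof -
    define \<theta> where "\<theta> = (s - \<alpha>) / (\<beta> - \<alpha>)"
    have th: "0 \<le> \<theta>" "\<theta> \<le> 1" using s le by (auto simp: \<theta>_def)
    have XY: "X s = (1 - \<theta>) * A $ 1 + \<theta> * B $ 1" "Y s = (1 - \<theta>) * A $ 2 + \<theta> * B $ 2"
      by (simp_all add: X_def Y_def X'_def Y'_def \<theta>_def algebra_simps add_divide_distrib diff_divide_distrib)
    have cvx: "((1 - \<theta>) * u + \<theta> * v)\<^sup>2 \<le> (1 - \<theta>) * u\<^sup>2 + \<theta> * v\<^sup>2" for u v :: real
    proof -
      have "(1 - \<theta>) * u\<^sup>2 + \<theta> * v\<^sup>2 - ((1 - \<theta>) * u + \<theta> * v)\<^sup>2 = \<theta> * (1 - \<theta>) * (u - v)\<^sup>2"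
        by algebra
      moreover have "\<dots> \<ge> 0" using th by simp
      ultimately show ?thesis by linarith
    qed
    have "(1 - \<theta>) * m\<^sup>2 + \<theta> * m\<^sup>2 \<le> (1 - \<theta>) * (A $ 3)\<^sup>2 + \<theta> * (B $ 3)\<^sup>2"
      using m2 th by (intro add_mono mult_left_mono) auto
    then have "m\<^sup>2 \<le> (1 - \<theta>) * (A $ 3)\<^sup>2 + \<theta> * (B $ 3)\<^sup>2" by (simp add: algebra_simps)
    also have "\<dots> \<le> q s"
      using cvx[of "A $ 1" "B $ 1"] cvx[of "A $ 2" "B $ 2"]
      unfolding q_def XY sA by (simp add: algebra_simps)
    finally show ?thesis .
  qed
  have q0: "q s > 0" if "s \<in> {\<alpha>..\<beta>}" for s
    using qm[OF that] m by (smt (verit) zero_less_power)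
  have absZ: "m \<le> \<bar>Z s\<bar>" if "s \<in> {\<alpha>..\<beta>}" for s
    using real_le_rsqrt[OF qm[OF that]] \<sigma> q0[OF that] by (simp add: Z_def abs_mult)
  have Z0: "Z s \<noteq> 0" if "s \<in> {\<alpha>..\<beta>}" for s
    using absZ[OF that] m by auto
  have dX: "(X has_real_derivative X') (at s within S)" for s S
    unfolding X_def by (auto intro!: derivative_eq_intros)
  have dY: "(Y has_real_derivative Y') (at s within S)" for s S
    unfolding Y_def by (auto intro!: derivative_eq_intros)
  have dZ: "(Z has_real_derivative - (X s * X' + Y s * Y') / Z s) (at s within S)"
    if "s \<in> {\<alpha>..\<beta>}" for s S
  proof -
    have "((\<lambda>s. sqrt (q s)) has_real_derivative
        inverse (sqrt (q s)) / 2 * (- (2 * X s * X') - 2 * Y s * Y')) (at s within S)"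
    proof (rule DERIV_chain2[where f = sqrt and g = q, OF DERIV_real_sqrt[OF q0[OF that]]])
      show "(q has_real_derivative - (2 * X s * X') - 2 * Y s * Y') (at s within S)"
        unfolding q_def by (auto intro!: derivative_eq_intros dX dY)
    qed
    from DERIV_cmult[OF this, of \<sigma>]
    show ?thesis
      unfolding Z_def using q0[OF that] \<sigma>2 \<sigma>
      by (elim DERIV_cong) (auto simp: field_simps abs_if power2_eq_square split: if_splits)
  qed
  define \<eta> :: "real \<Rightarrow> real^3" where "\<eta> s = vector [X s, Y s, Z s]" for s
  have n\<eta>: "norm (\<eta> s) = 1" if "s \<in> {\<alpha>..\<beta>}" for s
  proof -
    have "(norm (\<eta> s))\<^sup>2 = 1"
      using q0[OF that] unfolding norm_vec3
      by (simp add: \<eta>_def Z_def power_mult_distrib \<sigma>2) (simp add: q_def)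
    then show ?thesis using norm_ge_zero[of "\<eta> s"] by (auto simp: power2_eq_1_iff simp del: norm_ge_zero)
  qed
  let ?l = "sqrt ((B $ 1 - A $ 1)\<^sup>2 + (B $ 2 - A $ 2)\<^sup>2 / (1 - a\<^sup>2))"
  have "ar_path a \<alpha> \<beta> ((\<beta> - \<alpha>) * (?l / (\<beta> - \<alpha>) / m)) \<eta>"
  proof (rule ar_path_smooth[where ?u1.0 = "\<lambda>s. - X' / Z s" and ?u2.0 = "\<lambda>s. Y' / (c * Z s)"])
    fix s assume s: "s \<in> {\<alpha>..\<beta>}"
    have "(\<eta> has_vector_derivative vector [X', Y', - (X s * X' + Y s * Y') / Z s]) (at s within {\<alpha>..\<beta>})"
      unfolding \<eta>_def by (intro has_vector_derivative_vec3 dX dY dZ s)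
    also have "vector [X', Y', - (X s * X' + Y s * Y') / Z s] =
        cross3 (\<eta> s) (ar_axis a (- X' / Z s) (Y' / (c * Z s)))"
      using Z0[OF s] c(1)
      by (simp add: vec_eq_iff forall_3 cross3_def \<eta>_def ar_axis_def axis_def c_def[symmetric] field_simps)
    finally show "(\<eta> has_vector_derivative
        cross3 (\<eta> s) (ar_axis a (- X' / Z s) (Y' / (c * Z s)))) (at s within {\<alpha>..\<beta>})" .
    have "(- X' / Z s)\<^sup>2 + (Y' / (c * Z s))\<^sup>2 =
        ((B $ 1 - A $ 1)\<^sup>2 + (B $ 2 - A $ 2)\<^sup>2 / c\<^sup>2) / (\<beta> - \<alpha>)\<^sup>2 / (Z s)\<^sup>2"
      unfolding X'_def Y'_def by (simp add: power_divide power_mult_distrib add_divide_distrib)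
    then have "sqrt ((- X' / Z s)\<^sup>2 + (Y' / (c * Z s))\<^sup>2) = ?l / (\<beta> - \<alpha>) / \<bar>Z s\<bar>"
      using le by (simp only: real_sqrt_divide real_sqrt_abs c(2) abs_of_pos diff_gt_0_iff_gt)
    also have "\<dots> \<le> ?l / (\<beta> - \<alpha>) / m"
      using absZ[OF s] m le c(1) unfolding c(2)[symmetric] by (intro divide_left_mono mult_pos_pos) auto
    finally show "sqrt ((- X' / Z s)\<^sup>2 + (Y' / (c * Z s))\<^sup>2) \<le> ?l / (\<beta> - \<alpha>) / m" .
  next
    have "continuous_on {\<alpha>..\<beta>} Z"
      by (rule DERIV_continuous_on[OF dZ])
    then show "continuous_on {\<alpha>..\<beta>} (\<lambda>s. - X' / Z s)" "continuous_on {\<alpha>..\<beta>} (\<lambda>s. Y' / (c * Z s))"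
      using Z0 c(1) by (auto intro!: continuous_on_minus continuous_on_divide continuous_on_mult continuous_on_const)
  qed (use le n\<eta> in auto)
  moreover have "(\<beta> - \<alpha>) * (?l / (\<beta> - \<alpha>) / m) = ?l / m" using le by simp
  moreover have "\<eta> \<alpha> = A" "\<eta> \<beta> = B"
    using ends endZ by (simp_all add: \<eta>_def vec_eq_iff forall_3)
  ultimately show ?thesis using that by metis
qed

lemma polar_arctan:
  fixes y z :: real
  assumes "y \<noteq> 0"
  obtains \<rho> where "\<rho> * cos (arctan (z / y)) = y" "\<rho> * sin (arctan (z / y)) = z"
proof
  have *: "1 + (z / y)\<^sup>2 \<noteq> 0" by (smt (verit) zero_le_power2)
  show "y * sqrt (1 + (z / y)\<^sup>2) * cos (arctan (z / y)) = y"
    using * by (simp add: cos_arctan)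
  show "y * sqrt (1 + (z / y)\<^sup>2) * sin (arctan (z / y)) = z"
    using * assms by (simp add: sin_arctan)
qed

text \<open>The rotation by angles from \<open>-\<theta>\<close> to \<open>\<theta>\<close> in the plane of the coordinates \<open>j\<close> and \<open>3\<close>, where \<open>\<theta>\<close> is
the slope angle of the projection of \<open>B\<close>. The hypothesis on \<open>v1\<close> and \<open>v2\<close> says that they are a control
for rotating in that plane at unit angular speed. The arc crosses the circle \<open>z = 0\<close>, which a chord could not do.\<close>

lemma arc_path:
  assumes le: "\<alpha> < \<beta>" and B: "norm B = 1" "B $ j \<noteq> 0" and j: "j \<noteq> 3"
    and rot: "\<And>w. cross3 w (ar_axis a v1 v2) = w $ j *\<^sub>R axis 3 1 - w $ 3 *\<^sub>R axis j 1"
  obtains \<eta> where "\<eta> \<alpha> = reflect 3 B" "\<eta> \<beta> = B"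
    "ar_path a \<alpha> \<beta> (2 * \<bar>arctan (B $ 3 / B $ j)\<bar> * sqrt (v1\<^sup>2 + v2\<^sup>2)) \<eta>"
proof -
  define \<theta> where "\<theta> = arctan (B $ 3 / B $ j)"
  obtain \<rho> where \<rho>: "\<rho> * cos \<theta> = B $ j" "\<rho> * sin \<theta> = B $ 3"
    unfolding \<theta>_def using polar_arctan[OF B(2)] .
  define \<omega> where "\<omega> = 2 * \<theta> / (\<beta> - \<alpha>)"
  define \<psi> where "\<psi> s = (s - \<alpha>) * \<omega> - \<theta>" for s
  have d: "(\<psi> has_real_derivative \<omega>) (at s within S)" for s S
    unfolding \<psi>_def by (auto intro!: derivative_eq_intros)
  define \<eta> :: "real \<Rightarrow> real^3" where
    "\<eta> s = (\<rho> * cos (\<psi> s) - B $ j) *\<^sub>R axis j 1 + (\<rho> * sin (\<psi> s) - B $ 3) *\<^sub>R axis 3 1 + B" for s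
  have nth: "\<eta> s $ j = \<rho> * cos (\<psi> s)" "\<eta> s $ 3 = \<rho> * sin (\<psi> s)"
    "i \<noteq> j \<Longrightarrow> i \<noteq> 3 \<Longrightarrow> \<eta> s $ i = B $ i" for s i
    using j by (auto simp: \<eta>_def axis_def)
  have ends: "\<psi> \<alpha> = - \<theta>" "\<psi> \<beta> = \<theta>" using le by (auto simp: \<psi>_def \<omega>_def)
  have "\<eta> \<alpha> = reflect 3 B" "\<eta> \<beta> = B"
    using \<rho> j by (simp_all add: \<eta>_def ends vec_eq_iff axis_def)
  moreover have "ar_path a \<alpha> \<beta> ((\<beta> - \<alpha>) * (\<bar>\<omega>\<bar> * sqrt (v1\<^sup>2 + v2\<^sup>2))) \<eta>"
  proof (rule ar_path_smooth[where ?u1.0 = "\<lambda>s. \<omega> * v1" and ?u2.0 = "\<lambda>s. \<omega> * v2"])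
    fix s assume s: "s \<in> {\<alpha>..\<beta>}"
    have "(\<eta> has_vector_derivative (\<rho> * (- sin (\<psi> s) * \<omega>)) *\<^sub>R axis j 1 +
        (\<rho> * (cos (\<psi> s) * \<omega>)) *\<^sub>R axis 3 1) (at s within {\<alpha>..\<beta>})"
      unfolding \<eta>_def has_vector_derivative_def
      by (auto intro!: derivative_eq_intros d[unfolded has_field_derivative_def] simp: algebra_simps)
    also have "(\<rho> * (- sin (\<psi> s) * \<omega>)) *\<^sub>R axis j 1 + (\<rho> * (cos (\<psi> s) * \<omega>)) *\<^sub>R axis 3 1 =
        cross3 (\<eta> s) (ar_axis a (\<omega> * v1) (\<omega> * v2))"
    proof -
      have "ar_axis a (\<omega> * v1) (\<omega> * v2) = \<omega> *\<^sub>R ar_axis a v1 v2"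
        by (simp add: ar_axis_def algebra_simps)
      then show ?thesis
        by (simp add: cross_mult_right rot nth scaleR_diff_right mult_ac)
    qed
    finally show "(\<eta> has_vector_derivative cross3 (\<eta> s) (ar_axis a (\<omega> * v1) (\<omega> * v2)))
        (at s within {\<alpha>..\<beta>})" .
    have "\<rho>\<^sup>2 * ((cos u)\<^sup>2 + (sin u)\<^sup>2) = \<rho>\<^sup>2" for u by simp
    from this[of "\<psi> s"] this[of \<theta>]
    have "(\<rho> * cos (\<psi> s))\<^sup>2 + (\<rho> * sin (\<psi> s))\<^sup>2 = (\<rho> * cos \<theta>)\<^sup>2 + (\<rho> * sin \<theta>)\<^sup>2"
      by (simp only: power_mult_distrib distrib_left)
    then have "(\<eta> s $ j)\<^sup>2 + (\<eta> s $ 3)\<^sup>2 = (B $ j)\<^sup>2 + (B $ 3)\<^sup>2"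
      by (simp add: nth \<rho>)
    then have "(norm (\<eta> s))\<^sup>2 = (norm B)\<^sup>2"
      unfolding norm_vec3 using exhaust_3[of j] j nth(3)[of 1 s] nth(3)[of 2 s] by auto
    then show "norm (\<eta> s) = 1" using B by (simp only: power2_eq_iff_nonneg norm_ge_zero)
    show "sqrt ((\<omega> * v1)\<^sup>2 + (\<omega> * v2)\<^sup>2) \<le> \<bar>\<omega>\<bar> * sqrt (v1\<^sup>2 + v2\<^sup>2)"
      by (simp add: power_mult_distrib real_sqrt_mult flip: distrib_left)
  qed (use le in auto)
  moreover have "(\<beta> - \<alpha>) * (\<bar>\<omega>\<bar> * sqrt (v1\<^sup>2 + v2\<^sup>2)) = 2 * \<bar>\<theta>\<bar> * sqrt (v1\<^sup>2 + v2\<^sup>2)"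
    using le by (simp add: \<omega>_def abs_mult)
  ultimately show ?thesis
    using that unfolding \<theta>_def by metis
qed

section \<open>Asymptotics at the return time\<close>

lemma tendsto_difference_quotients:
  fixes f :: "real \<Rightarrow> real"
  assumes "(f has_real_derivative d) (at \<tau>)"
  shows "((\<lambda>r. (f (\<tau> + r) - f \<tau>) / r) \<longlongrightarrow> d) (at_right 0)"
    and "((\<lambda>r. (f (\<tau> - r) - f \<tau>) / r) \<longlongrightarrow> - d) (at_right 0)"
proof -
  have *: "((\<lambda>h. (f (\<tau> + h) - f \<tau>) / h) \<longlongrightarrow> d) (at 0)"
    using assms by (simp add: DERIV_def)
  then show "((\<lambda>r. (f (\<tau> + r) - f \<tau>) / r) \<longlongrightarrow> d) (at_right 0)"
    by (rule filterlim_mono) (auto simp: at_le)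
  have "filterlim (\<lambda>r::real. - r) (at 0) (at_right 0)"
    by (auto simp: filterlim_at eventually_at_filter intro!: tendsto_eq_intros)
  from tendsto_minus[OF filterlim_compose[OF * this]]
  show "((\<lambda>r. (f (\<tau> - r) - f \<tau>) / r) \<longlongrightarrow> - d) (at_right 0)"
    by simp
qed

lemma tendsto_symmetric_quotients:
  fixes f :: "real \<Rightarrow> real"
  assumes "(f has_real_derivative d) (at \<tau>)"
  shows "((\<lambda>r. (f (\<tau> + r) - f (\<tau> - r)) / r) \<longlongrightarrow> 2 * d) (at_right 0)"
    and "f \<tau> = 0 \<Longrightarrow> ((\<lambda>r. (f (\<tau> + r) + f (\<tau> - r)) / r) \<longlongrightarrow> 0) (at_right 0)"
  using tendsto_diff[OF tendsto_difference_quotients[OF assms]]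
    tendsto_add[OF tendsto_difference_quotients[OF assms]]
  by (simp_all add: diff_divide_distrib add_divide_distrib)

text \<open>The first-order terms cancel because \<open>g\<close> vanishes at \<open>\<tau>\<close>, and the second-order terms because \<open>r\<close>
and \<open>-r\<close> have the same square. By l'Hopital's rule it is enough that \<open>(g (\<tau> + r) + g (\<tau> - r)) / r\<close>
tends to 0.\<close>

lemma tendsto_symmetric_second_quotient:
  fixes f g :: "real \<Rightarrow> real"
  assumes df: "\<And>s. 0 < s \<Longrightarrow> (f has_real_derivative g s) (at s)"
    and dg: "(g has_real_derivative d) (at \<tau>)" and g0: "g \<tau> = 0" and \<tau>: "0 < \<tau>"
  shows "((\<lambda>r. (f (\<tau> + r) - f (\<tau> - r)) / r\<^sup>2) \<longlongrightarrow> 0) (at_right 0)"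
proof (rule lhopital_right_0)
  have c: "isCont f \<tau>" using df[OF \<tau>] DERIV_isCont by blast
  have "((\<lambda>r. f (\<tau> + r) - f (\<tau> - r)) \<longlongrightarrow> f \<tau> - f \<tau>) (at_right 0)"
    by (intro tendsto_diff isCont_tendsto_compose[OF c]) (auto intro!: tendsto_eq_intros)
  then show "((\<lambda>r. f (\<tau> + r) - f (\<tau> - r)) \<longlongrightarrow> 0) (at_right 0)" by simp
  show "((\<lambda>r::real. r\<^sup>2) \<longlongrightarrow> 0) (at_right 0)" by (auto intro!: tendsto_eq_intros)
  show "\<forall>\<^sub>F r::real in at_right 0. r\<^sup>2 \<noteq> 0" "\<forall>\<^sub>F r::real in at_right 0. 2 * r \<noteq> 0"
    by (auto simp: eventually_at_filter)
  show "\<forall>\<^sub>F r in at_right 0. ((\<lambda>r. f (\<tau> + r) - f (\<tau> - r)) has_real_derivative g (\<tau> + r) + g (\<tau> - r)) (at r)"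
    using eventually_at_right_real[OF \<tau>]
  proof eventually_elim
    case (elim r)
    then have "(f has_real_derivative g (\<tau> + r)) (at (\<tau> + r))"
      "(f has_real_derivative g (\<tau> - r)) (at (\<tau> - r))"
      using df \<tau> by auto
    then show ?case
      by (auto intro!: derivative_eq_intros DERIV_chain2[where f = f])
  qed
  show "\<forall>\<^sub>F r::real in at_right 0. ((\<lambda>r. r\<^sup>2) has_real_derivative 2 * r) (at r)"
    by (auto intro!: always_eventually derivative_eq_intros)
  show "((\<lambda>r. (g (\<tau> + r) + g (\<tau> - r)) / (2 * r)) \<longlongrightarrow> 0) (at_right 0)"
    using tendsto_divide[OF tendsto_symmetric_quotients(2)[OF dg g0] tendsto_const[of 2]] by (simp add: mult.commute)
qed

text \<open>This compares latitude with arclength for an extremal through a point where \<open>z = 0\<close> and one further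
coordinate \<open>X\<close> vanishes. The angle \<open>arctan (Z / Y)\<close> has derivative
\<open>\<kappa> Q + \<mu> P X Y / (Y\<^sup>2 + Z\<^sup>2)\<close>. Its first term is smaller than \<open>\<bar>\<kappa>\<bar>\<close> by about \<open>\<bar>\<kappa>\<bar> P\<^sup>2 / 2\<close>, since
\<open>P\<^sup>2 + Q\<^sup>2 = 1\<close>. As \<open>P\<close> vanishes to first order and \<open>X\<close> to higher order, the second term cannot
compensate this deficit. The parameters let the lemma serve both pairs of coordinates.\<close>

lemma eventually_arctan_quotient_less:
  fixes X Y Z P Q :: "real \<Rightarrow> real"
  assumes \<tau>: "0 < \<tau>" and \<kappa>: "\<kappa> \<noteq> 0"
    and dY: "\<And>s. 0 < s \<Longrightarrow> (Y has_real_derivative - \<kappa> * Q s * Z s) (at s)"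
    and dZ: "\<And>s. 0 < s \<Longrightarrow> (Z has_real_derivative \<kappa> * Q s * Y s + \<mu> * P s * X s) (at s)"
    and PQ: "\<And>s. 0 < s \<Longrightarrow> (P s)\<^sup>2 + (Q s)\<^sup>2 = 1"
    and dX: "(X has_real_derivative 0) (at \<tau>)" and X0: "X \<tau> = 0"
    and dP: "(P has_real_derivative p) (at \<tau>)" and P0: "P \<tau> = 0" and p: "p \<noteq> 0"
    and Z0: "Z \<tau> = 0" and Y1: "\<bar>Y \<tau>\<bar> = 1"
  shows "\<forall>\<^sub>F r in at_right 0. Y (\<tau> + r) \<noteq> 0 \<and> \<bar>arctan (Z (\<tau> + r) / Y (\<tau> + r))\<bar> < \<bar>\<kappa>\<bar> * r"
proof -
  have "isCont Y \<tau>" using dY[OF \<tau>] DERIV_isCont by blast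
  then have "((\<lambda>r. \<bar>Y (\<tau> + r)\<bar>) \<longlongrightarrow> \<bar>Y \<tau>\<bar>) (at_right 0)"
    by (intro tendsto_rabs isCont_tendsto_compose[of _ Y]) (auto intro!: tendsto_eq_intros)
  then have e1: "\<forall>\<^sub>F r in at_right 0. 1 / 2 < \<bar>Y (\<tau> + r)\<bar>"
    by (rule order_tendstoD) (simp add: Y1)
  \<comment> \<open>the bounds \<open>\<bar>p\<bar> / 2\<close> for \<open>P\<close> and \<open>\<bar>\<kappa>\<bar> * \<bar>p\<bar> / 8\<close> for \<open>\<mu> X\<close> together give \<open>\<bar>\<mu> X\<bar> < \<bar>\<kappa>\<bar> * \<bar>P\<bar> / 4\<close>\<close>
  have "((\<lambda>r. \<bar>\<mu> * ((X (\<tau> + r) - X \<tau>) / r)\<bar>) \<longlongrightarrow> \<bar>\<mu> * 0\<bar>) (at_right 0)"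
    by (intro tendsto_intros tendsto_difference_quotients(1)[OF dX])
  then have e2: "\<forall>\<^sub>F r in at_right 0. \<bar>\<mu> * ((X (\<tau> + r) - X \<tau>) / r)\<bar> < \<bar>\<kappa>\<bar> * \<bar>p\<bar> / 8"
    by (rule order_tendstoD) (use \<kappa> p in simp)
  have "((\<lambda>r. \<bar>(P (\<tau> + r) - P \<tau>) / r\<bar>) \<longlongrightarrow> \<bar>p\<bar>) (at_right 0)"
    by (intro tendsto_intros tendsto_difference_quotients(1)[OF dP])
  then have e3: "\<forall>\<^sub>F r in at_right 0. \<bar>p\<bar> / 2 < \<bar>(P (\<tau> + r) - P \<tau>) / r\<bar>"
    by (rule order_tendstoD) (use p in simp)
  have "\<forall>\<^sub>F r in at_right 0. 0 < r \<and> Y (\<tau> + r) \<noteq> 0 \<and>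
      \<bar>\<kappa> * Q (\<tau> + r) + \<mu> * P (\<tau> + r) * X (\<tau> + r) * Y (\<tau> + r) / ((Y (\<tau> + r))\<^sup>2 + (Z (\<tau> + r))\<^sup>2)\<bar> < \<bar>\<kappa>\<bar>"
    using e1 e2 e3 eventually_at_right_less[of 0]
  proof eventually_elim
    case (elim r)
    let ?X = "X (\<tau> + r)" and ?Y = "Y (\<tau> + r)" and ?Z = "Z (\<tau> + r)" and ?P = "P (\<tau> + r)"
      and ?Q = "Q (\<tau> + r)"
    have "\<bar>\<mu>\<bar> * \<bar>?X\<bar> < \<bar>\<kappa>\<bar> * \<bar>p\<bar> / 8 * r"
      using elim by (simp add: X0 abs_mult pos_divide_less_eq)
    moreover have "\<bar>p\<bar> / 2 * r < \<bar>?P\<bar>"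
      using elim by (simp add: P0 pos_less_divide_eq)
    then have "\<bar>\<kappa>\<bar> / 4 * (\<bar>p\<bar> / 2 * r) < \<bar>\<kappa>\<bar> / 4 * \<bar>?P\<bar>"
      using \<kappa> by (intro mult_strict_left_mono) auto
    ultimately have \<mu>X: "\<bar>\<mu>\<bar> * \<bar>?X\<bar> < \<bar>\<kappa>\<bar> / 4 * \<bar>?P\<bar>" by (simp add: mult_ac)
    have P: "0 < \<bar>?P\<bar>" using \<open>\<bar>p\<bar> / 2 * r < \<bar>?P\<bar>\<close> elim by (smt (verit) divide_nonneg_pos mult_nonneg_nonneg)
    have Y: "?Y \<noteq> 0" using elim by auto
    have "\<bar>?Y\<bar> / (?Y\<^sup>2 + ?Z\<^sup>2) \<le> \<bar>?Y\<bar> / ?Y\<^sup>2"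
      using Y by (intro divide_left_mono) (auto intro!: mult_pos_pos add_pos_nonneg)
    also have "\<dots> = 1 / \<bar>?Y\<bar>"
      using Y by (simp add: power2_eq_square abs_if field_simps)
    also have "\<dots> \<le> 2" using elim by (simp add: divide_le_eq)
    finally have Y2: "\<bar>?Y\<bar> / (?Y\<^sup>2 + ?Z\<^sup>2) \<le> 2" .
    have "\<bar>\<mu> * ?P * ?X * ?Y / (?Y\<^sup>2 + ?Z\<^sup>2)\<bar> = \<bar>?P\<bar> * (\<bar>\<mu>\<bar> * \<bar>?X\<bar>) * (\<bar>?Y\<bar> / (?Y\<^sup>2 + ?Z\<^sup>2))"
      by (simp add: abs_mult)
    also have "\<dots> \<le> \<bar>?P\<bar> * (\<bar>\<mu>\<bar> * \<bar>?X\<bar>) * 2"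
      by (intro mult_left_mono Y2) simp
    also have "\<dots> < \<bar>?P\<bar> * (\<bar>\<kappa>\<bar> / 4 * \<bar>?P\<bar>) * 2"
      using mult_strict_left_mono[OF \<mu>X P] by linarith
    also have "\<dots> = \<bar>\<kappa>\<bar> * (?P\<^sup>2 / 2)" by (simp add: power2_eq_square)
    finally have 1: "\<bar>\<mu> * ?P * ?X * ?Y / (?Y\<^sup>2 + ?Z\<^sup>2)\<bar> < \<bar>\<kappa>\<bar> * (?P\<^sup>2 / 2)" .
    have pq: "?P\<^sup>2 + ?Q\<^sup>2 = 1" using PQ[of "\<tau> + r"] \<tau> elim by simp
    have "(1 - ?P\<^sup>2 / 2)\<^sup>2 - ?Q\<^sup>2 = (?P\<^sup>2 / 2)\<^sup>2"
      using pq by (simp add: power2_diff)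
    then have "?Q\<^sup>2 \<le> (1 - ?P\<^sup>2 / 2)\<^sup>2" by (smt (verit) zero_le_power2)
    moreover have "?P\<^sup>2 \<le> 1" using pq by (smt (verit) zero_le_power2)
    ultimately have "\<bar>?Q\<bar> \<le> 1 - ?P\<^sup>2 / 2" by (auto simp: abs_le_square_iff[symmetric])
    then have "\<bar>\<kappa>\<bar> * \<bar>?Q\<bar> \<le> \<bar>\<kappa>\<bar> * (1 - ?P\<^sup>2 / 2)" by (intro mult_left_mono) auto
    then have "\<bar>\<kappa> * ?Q\<bar> \<le> \<bar>\<kappa>\<bar> - \<bar>\<kappa>\<bar> * (?P\<^sup>2 / 2)" by (simp add: abs_mult algebra_simps)
    with 1 Y elim show ?case by linarith
  qed
  then obtain b where b: "b > 0" and good: "\<And>r. 0 < r \<Longrightarrow> r < b \<Longrightarrow> Y (\<tau> + r) \<noteq> 0 \<and>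
      \<bar>\<kappa> * Q (\<tau> + r) + \<mu> * P (\<tau> + r) * X (\<tau> + r) * Y (\<tau> + r) / ((Y (\<tau> + r))\<^sup>2 + (Z (\<tau> + r))\<^sup>2)\<bar> < \<bar>\<kappa>\<bar>"
    unfolding eventually_at_right_field by auto
  define \<phi> where "\<phi> s = arctan (Z s / Y s)" for s
  define \<phi>' where "\<phi>' s = \<kappa> * Q s + \<mu> * P s * X s * Y s / ((Y s)\<^sup>2 + (Z s)\<^sup>2)" for s
  have d\<phi>: "(\<phi> has_real_derivative \<phi>' s) (at s)" if "0 < s" "Y s \<noteq> 0" for s
  proof -
    have pos: "(Y s)\<^sup>2 + (Z s)\<^sup>2 \<noteq> 0" using that by (simp add: sum_power2_eq_zero_iff)
    have "(\<phi> has_real_derivative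
       inverse (1 + (Z s / Y s)\<^sup>2) *
       (((\<kappa> * Q s * Y s + \<mu> * P s * X s) * Y s - Z s * (- \<kappa> * Q s * Z s)) / (Y s * Y s))) (at s)"
      unfolding \<phi>_def
      by (rule DERIV_chain2[OF DERIV_arctan DERIV_divide[OF dZ dY]]) (use that in auto)
    moreover have "inverse (1 + (Z s / Y s)\<^sup>2) *
       (((\<kappa> * Q s * Y s + \<mu> * P s * X s) * Y s - Z s * (- \<kappa> * Q s * Z s)) / (Y s * Y s)) = \<phi>' s"
    proof -
      have "inverse (1 + (Z s / Y s)\<^sup>2) = (Y s)\<^sup>2 / ((Y s)\<^sup>2 + (Z s)\<^sup>2)"
        using that pos by (simp add: field_simps power_divide)
      moreover have "(\<kappa> * Q s * Y s + \<mu> * P s * X s) * Y s - Z s * (- \<kappa> * Q s * Z s) =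
          \<kappa> * Q s * ((Y s)\<^sup>2 + (Z s)\<^sup>2) + \<mu> * P s * X s * Y s"
        by (simp add: algebra_simps power2_eq_square)
      moreover have "y\<^sup>2 / d * ((A * d + B) / (y * y)) = A + B / d" if "y \<noteq> 0" "d \<noteq> 0" for y d A B :: real
        using that by (simp add: field_simps power2_eq_square)
      ultimately show ?thesis
        unfolding \<phi>'_def using that(2) pos by metis
    qed
    ultimately show ?thesis by simp
  qed
  have "\<bar>\<phi> (\<tau> + r)\<bar> < \<bar>\<kappa>\<bar> * r" if r: "0 < r" "r < b" for r
  proof -
    have nz: "Y s \<noteq> 0" if "\<tau> \<le> s" "s \<le> \<tau> + r" for s
      using good[of "s - \<tau>"] that r Y1 by (cases "s = \<tau>") auto
    obtain \<xi> where \<xi>: "\<tau> < \<xi>" "\<xi> < \<tau> + r" "\<phi> (\<tau> + r) - \<phi> \<tau> = (\<tau> + r - \<tau>) * \<phi>' \<xi>"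
      using MVT2[of \<tau> "\<tau> + r" \<phi> \<phi>'] d\<phi> nz \<tau> r by auto
    have "\<bar>\<phi>' \<xi>\<bar> < \<bar>\<kappa>\<bar>"
      using good[of "\<xi> - \<tau>"] \<xi> r unfolding \<phi>'_def by auto
    then show ?thesis
      using \<xi>(3) r by (simp add: \<phi>_def Z0 abs_mult mult.commute)
  qed
  then show ?thesis
    using good b unfolding eventually_at_right_field \<phi>_def by (intro exI[of _ b]) auto
qed

section \<open>Shortcuts at the return time\<close>

lemma extremal_component_derivs:
  assumes e: "ar_extremal a {0..} \<gamma> M" and s: "0 < s"
  shows "((\<lambda>s. \<gamma> s $ 1) has_real_derivative - (\<gamma> s $ 3 * M s $ 2)) (at s)"
    and "((\<lambda>s. \<gamma> s $ 2) has_real_derivative (1 - a\<^sup>2) * \<gamma> s $ 3 * M s $ 1) (at s)"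
    and "((\<lambda>s. \<gamma> s $ 3) has_real_derivative \<gamma> s $ 1 * M s $ 2 - (1 - a\<^sup>2) * \<gamma> s $ 2 * M s $ 1) (at s)"
    and "((\<lambda>s. M s $ 1) has_real_derivative - (M s $ 3 * M s $ 2)) (at s)"
    and "((\<lambda>s. M s $ 2) has_real_derivative (1 - a\<^sup>2) * M s $ 3 * M s $ 1) (at s)"
proof -
  have at: "at s within {0..} = at s"
    by (rule at_within_interior) (use s in simp)
  have comp: "((\<lambda>s. f s $ i) has_real_derivative f' $ i) (at s)"
    if "(f has_vector_derivative f') (at s within {0..})" for f :: "real \<Rightarrow> real^3" and f' i
    using bounded_linear.has_vector_derivative[OF bounded_linear_vec_nth that, of i]
    by (simp add: at has_real_derivative_iff_has_vector_derivative)
  have s': "s \<in> {0..}" using s by simp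
  note D = comp[OF ar_extremalD(1)[OF e s']] comp[OF ar_extremalD(2)[OF e s']]
  show "((\<lambda>s. \<gamma> s $ 1) has_real_derivative - (\<gamma> s $ 3 * M s $ 2)) (at s)"
    using D(1)[of 1] by (simp add: cross3_def)
  show "((\<lambda>s. \<gamma> s $ 2) has_real_derivative (1 - a\<^sup>2) * \<gamma> s $ 3 * M s $ 1) (at s)"
    using D(1)[of 2] by (simp add: cross3_def mult_ac)
  show "((\<lambda>s. \<gamma> s $ 3) has_real_derivative \<gamma> s $ 1 * M s $ 2 - (1 - a\<^sup>2) * \<gamma> s $ 2 * M s $ 1) (at s)"
    using D(1)[of 3] by (simp add: cross3_def mult_ac)
  show "((\<lambda>s. M s $ 1) has_real_derivative - (M s $ 3 * M s $ 2)) (at s)"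
    using D(2)[of 1] by (simp add: cross3_def)
  show "((\<lambda>s. M s $ 2) has_real_derivative (1 - a\<^sup>2) * M s $ 3 * M s $ 1) (at s)"
    using D(2)[of 2] by (simp add: cross3_def mult_ac)
qed

lemma extremal_unit_momentum:
  assumes "ar_extremal a S \<gamma> M" "s \<in> S"
  shows "(1 - a\<^sup>2) * (M s $ 1)\<^sup>2 + (M s $ 2)\<^sup>2 = 1"
  using ar_extremalD(5)[OF assms] by (simp add: inner_vec_def sum_3 power2_eq_square mult_ac)

lemma extremal_momentum_tangent:
  assumes "ar_extremal a S \<gamma> M" "s \<in> S"
  shows "\<gamma> s $ 1 * M s $ 1 + \<gamma> s $ 2 * M s $ 2 + \<gamma> s $ 3 * M s $ 3 = 0"
  using ar_extremalD(4)[OF assms] by (simp add: inner_vec_def sum_3)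

lemma reflect_eq_self_iff: "reflect k v = v \<longleftrightarrow> v $ k = 0"
  by (auto simp: vec_eq_iff)

text \<open>Otherwise the geodesic and its reflection would have the same point and the same momentum at time
\<open>\<tau>\<close>, so they would coincide and the geodesic would lie in the plane.\<close>

lemma extremal_reflected_momentum_ne:
  assumes a: "0 \<le> a" "a \<le> 1" and e: "ar_extremal a {0..} \<gamma> M" and \<tau>: "0 \<le> \<tau>"
    and k: "\<gamma> \<tau> $ k = 0" and s: "0 \<le> s" "\<gamma> s $ k \<noteq> 0"
  shows "\<exists>i. i \<noteq> k \<and> M \<tau> $ i \<noteq> 0"
proof (rule ccontr)
  assume "\<not> ?thesis"
  then have "M \<tau> = - reflect k (M \<tau>)" by (auto simp: vec_eq_iff)
  moreover have "ar_extremal a {0..max s \<tau>} \<gamma> M"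
    by (rule ar_extremal_subset[OF e]) auto
  moreover have "\<gamma> \<tau> = reflect k (\<gamma> \<tau>)"
    using k by (metis reflect_eq_self_iff)
  ultimately have "\<gamma> s = reflect k (\<gamma> s)"
    using ar_extremal_unique[OF a _ ar_extremal_reflect, of 0 "max s \<tau>" \<gamma> M \<gamma> M \<tau> k s]
      \<tau> s(1) by auto
  then show False using s by (metis reflect_eq_self_iff)
qed

text \<open>Reversing time and applying the two reflections maps the geodesic to an extremal with the same point
and the same momentum at \<open>\<tau>\<close>, hence to itself. So the points \<open>\<tau> - r\<close> of the reflected geodesic and
\<open>\<tau> + r\<close> of the geodesic are mirror images in the plane \<open>z = 0\<close>.\<close>

lemma extremal_symmetric_at_pole:
  assumes a: "0 \<le> a" "a \<le> 1" and e: "ar_extremal a {0..} \<gamma> M" and r: "0 \<le> r" "r \<le> \<tau>"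
    and k: "\<gamma> \<tau> $ k = 0" "\<gamma> \<tau> $ 3 = 0" and M: "\<And>i. i \<noteq> k \<Longrightarrow> i \<noteq> 3 \<Longrightarrow> M \<tau> $ i = 0" and k3: "k \<noteq> 3"
  shows "reflect k (\<gamma> (\<tau> - r)) = reflect 3 (\<gamma> (\<tau> + r))"
proof -
  have e1: "ar_extremal a {0..2 * \<tau>} \<gamma> M"
    by (rule ar_extremal_subset[OF e]) auto
  have "(\<lambda>s. 2 * \<tau> - s) ` {0..2 * \<tau>} = {0..2 * \<tau>}" by simp
  with ar_extremal_reverse[OF e1, of "2 * \<tau>"]
  have "ar_extremal a {0..2 * \<tau>} (\<lambda>s. \<gamma> (2 * \<tau> - s)) (\<lambda>s. - M (2 * \<tau> - s))" by simp
  note e2 = ar_extremal_reflect[OF ar_extremal_reflect[OF this, of 3], of k]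
  have "reflect 3 (\<gamma> (2 * \<tau> - (\<tau> - r))) = reflect k (reflect k (reflect 3 (\<gamma> (2 * \<tau> - (\<tau> - r)))))" by simp
  also have "reflect k (reflect 3 (\<gamma> (2 * \<tau> - (\<tau> - r)))) = \<gamma> (\<tau> - r)"
  proof (rule ar_extremal_unique[OF a e2 e1, of \<tau>])
    show "reflect k (reflect 3 (\<gamma> (2 * \<tau> - \<tau>))) = \<gamma> \<tau>"
      using k by (simp add: vec_eq_iff)
    show "- reflect k (- reflect 3 (- M (2 * \<tau> - \<tau>))) = M \<tau>"
      using M k3 by (auto simp: vec_eq_iff)
  qed (use r in auto)
  finally show ?thesis by (simp add: algebra_simps)
qed

text \<open>The shortcut joins the time \<open>\<tau> - r\<close> of the reflected geodesic to the time \<open>\<tau> + r\<close> of the geodesic,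
which are at distance \<open>2 * r\<close> along the concatenation; \<open>m r\<close> bounds \<open>\<bar>z\<bar>\<close> at both of them.\<close>

lemma not_optimal_if_eventually_chord:
  assumes a: "0 \<le> a" "a < 1" and e: "ar_extremal a {0..} \<gamma> M" and \<tau>: "0 < \<tau>" "\<tau> < t"
    and k: "\<gamma> 0 $ k = 0" and \<sigma>: "\<bar>\<sigma>\<bar> = 1"
    and ev: "\<forall>\<^sub>F r in at_right 0. 0 < m r \<and> m r \<le> \<sigma> * reflect k (\<gamma> (\<tau> - r)) $ 3 \<and> m r \<le> \<sigma> * \<gamma> (\<tau> + r) $ 3 \<and>
       sqrt ((\<gamma> (\<tau> + r) $ 1 - reflect k (\<gamma> (\<tau> - r)) $ 1)\<^sup>2 +
             (\<gamma> (\<tau> + r) $ 2 - reflect k (\<gamma> (\<tau> - r)) $ 2)\<^sup>2 / (1 - a\<^sup>2)) < 2 * r * m r"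
  shows "\<not> ar_optimal a t \<gamma>"
proof -
  have "\<forall>\<^sub>F r in at_right 0. r < min \<tau> (t - \<tau>)"
    using \<tau> by (intro eventually_at_rightI[of 0 "min \<tau> (t - \<tau>)"]) auto
  from eventually_happens[OF eventually_conj[OF eventually_conj[OF ev this] eventually_at_right_less]]
  obtain r where r: "0 < r" "r < \<tau>" "\<tau> + r < t" and m: "0 < m r" "m r \<le> \<sigma> * reflect k (\<gamma> (\<tau> - r)) $ 3"
    "m r \<le> \<sigma> * \<gamma> (\<tau> + r) $ 3"
    and len: "sqrt ((\<gamma> (\<tau> + r) $ 1 - reflect k (\<gamma> (\<tau> - r)) $ 1)\<^sup>2 +
             (\<gamma> (\<tau> + r) $ 2 - reflect k (\<gamma> (\<tau> - r)) $ 2)\<^sup>2 / (1 - a\<^sup>2)) < 2 * r * m r"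
    by (auto simp del: reflect_nth)
  obtain \<eta> where \<eta>: "\<eta> (\<tau> - r) = reflect k (\<gamma> (\<tau> - r))" "\<eta> (\<tau> + r) = \<gamma> (\<tau> + r)"
    "ar_path a (\<tau> - r) (\<tau> + r) (sqrt ((\<gamma> (\<tau> + r) $ 1 - reflect k (\<gamma> (\<tau> - r)) $ 1)\<^sup>2 +
             (\<gamma> (\<tau> + r) $ 2 - reflect k (\<gamma> (\<tau> - r)) $ 2)\<^sup>2 / (1 - a\<^sup>2)) / m r) \<eta>"
    by (rule chord_path[OF a _ m(1) _ m(2) _ m(3) \<sigma>, of "\<tau> - r" "\<tau> + r"])
      (use r ar_extremalD(3)[OF e] in auto)
  show ?thesis
  proof (rule not_optimal_if_shortcut[where r = r and \<tau> = \<tau> and k = k and \<eta> = \<eta>])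
    show "ar_extremal a {0..t} \<gamma> M" by (rule ar_extremal_subset[OF e]) auto
    show "reflect k (\<gamma> 0) = \<gamma> 0" using k by (simp only: reflect_eq_self_iff)
  qed (use a r \<eta> len m(1) in \<open>auto simp: pos_divide_less_eq simp del: reflect_nth\<close>)
qed

text \<open>The corner case. For small \<open>r\<close> the chord has length about \<open>2 * r * sqrt (d1\<^sup>2 + d2\<^sup>2 / (1 - a\<^sup>2)) / \<bar>z\<bar>\<close>,
where \<open>(d1, d2)\<close> is the mean of the two velocities at the corner; this is less than \<open>2 * r\<close>.\<close>

lemma not_optimal_if_transversal:
  assumes a: "0 \<le> a" "a < 1" and e: "ar_extremal a {0..} \<gamma> M" and \<tau>: "0 < \<tau>" "\<tau> < t"
    and k: "\<gamma> 0 $ k = 0" "k \<noteq> 3" and z: "\<gamma> \<tau> $ 3 \<noteq> 0"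
    and l1: "((\<lambda>r. (\<gamma> (\<tau> + r) $ 1 - reflect k (\<gamma> (\<tau> - r)) $ 1) / r) \<longlongrightarrow> 2 * d1) (at_right 0)"
    and l2: "((\<lambda>r. (\<gamma> (\<tau> + r) $ 2 - reflect k (\<gamma> (\<tau> - r)) $ 2) / r) \<longlongrightarrow> 2 * d2) (at_right 0)"
    and lt: "d1\<^sup>2 + d2\<^sup>2 / (1 - a\<^sup>2) < (\<gamma> \<tau> $ 3)\<^sup>2"
  shows "\<not> ar_optimal a t \<gamma>"
proof -
  let ?D = "\<lambda>i r. \<gamma> (\<tau> + r) $ i - reflect k (\<gamma> (\<tau> - r)) $ i"
  let ?z = "\<lambda>s. \<gamma> s $ 3"
  have c: "1 - a\<^sup>2 > 0" using a by (simp add: abs_square_less_1)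
  have "sqrt (d1\<^sup>2 + d2\<^sup>2 / (1 - a\<^sup>2)) < \<bar>?z \<tau>\<bar>"
    using lt by (metis real_sqrt_abs real_sqrt_less_iff)
  \<comment> \<open>room for \<open>m\<close> to bound \<open>\<bar>z\<bar>\<close> near \<open>\<tau>\<close> from below while the chord stays short\<close>
  then obtain m where m: "sqrt (d1\<^sup>2 + d2\<^sup>2 / (1 - a\<^sup>2)) < m" "m < \<bar>?z \<tau>\<bar>"
    using dense by blast
  have m0: "0 < m" using m(1) c by (smt (verit) divide_nonneg_pos real_sqrt_ge_0_iff zero_le_power2)
  define \<sigma> where "\<sigma> = sgn (?z \<tau>)"
  have \<sigma>: "\<bar>\<sigma>\<bar> = 1" "\<sigma> * ?z \<tau> = \<bar>?z \<tau>\<bar>"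
    using z by (auto simp: \<sigma>_def sgn_if)
  have "isCont ?z \<tau>" using extremal_component_derivs(3)[OF e \<tau>(1)] DERIV_isCont by blast
  then have "((\<lambda>r. \<sigma> * ?z (\<tau> + r)) \<longlongrightarrow> \<sigma> * ?z \<tau>) (at_right 0)"
     "((\<lambda>r. \<sigma> * ?z (\<tau> - r)) \<longlongrightarrow> \<sigma> * ?z \<tau>) (at_right 0)"
    by (intro tendsto_mult tendsto_const isCont_tendsto_compose[of _ ?z]; auto intro!: tendsto_eq_intros)+
  then have e1: "\<forall>\<^sub>F r in at_right 0. m < \<sigma> * ?z (\<tau> + r)" "\<forall>\<^sub>F r in at_right 0. m < \<sigma> * ?z (\<tau> - r)"
    using m(2) \<sigma>(2) by (auto dest: order_tendstoD)
  have "((\<lambda>r. sqrt ((?D 1 r / r)\<^sup>2 + (?D 2 r / r)\<^sup>2 / (1 - a\<^sup>2))) \<longlongrightarrow>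
      sqrt ((2 * d1)\<^sup>2 + (2 * d2)\<^sup>2 / (1 - a\<^sup>2))) (at_right 0)"
    using c by (intro tendsto_intros l1 l2) auto
  moreover have "sqrt ((2 * d1)\<^sup>2 + (2 * d2)\<^sup>2 / (1 - a\<^sup>2)) = 2 * sqrt (d1\<^sup>2 + d2\<^sup>2 / (1 - a\<^sup>2))"
  proof -
    have "(2 * d1)\<^sup>2 + (2 * d2)\<^sup>2 / (1 - a\<^sup>2) = 2\<^sup>2 * (d1\<^sup>2 + d2\<^sup>2 / (1 - a\<^sup>2))"
      by (simp add: power_mult_distrib algebra_simps)
    then show ?thesis by (simp only: real_sqrt_mult) simp
  qed
  ultimately have "((\<lambda>r. sqrt ((?D 1 r / r)\<^sup>2 + (?D 2 r / r)\<^sup>2 / (1 - a\<^sup>2))) \<longlongrightarrow>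
      2 * sqrt (d1\<^sup>2 + d2\<^sup>2 / (1 - a\<^sup>2))) (at_right 0)" by metis
  then have "\<forall>\<^sub>F r in at_right 0. sqrt ((?D 1 r / r)\<^sup>2 + (?D 2 r / r)\<^sup>2 / (1 - a\<^sup>2)) < 2 * m"
    by (rule order_tendstoD) (use m(1) in linarith)
  then have "\<forall>\<^sub>F r in at_right 0. 0 < m \<and> m \<le> \<sigma> * reflect k (\<gamma> (\<tau> - r)) $ 3 \<and> m \<le> \<sigma> * \<gamma> (\<tau> + r) $ 3 \<and>
       sqrt ((?D 1 r)\<^sup>2 + (?D 2 r)\<^sup>2 / (1 - a\<^sup>2)) < 2 * r * m"
    using e1 eventually_at_right_less[of 0]
  proof eventually_elim
    case (elim r)
    have "(?D 1 r / r)\<^sup>2 + (?D 2 r / r)\<^sup>2 / (1 - a\<^sup>2) = ((?D 1 r)\<^sup>2 + (?D 2 r)\<^sup>2 / (1 - a\<^sup>2)) / r\<^sup>2"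
      by (simp only: power_divide add_divide_distrib divide_divide_eq_left mult.commute)
    then have "sqrt ((?D 1 r / r)\<^sup>2 + (?D 2 r / r)\<^sup>2 / (1 - a\<^sup>2)) =
        sqrt ((?D 1 r)\<^sup>2 + (?D 2 r)\<^sup>2 / (1 - a\<^sup>2)) / r"
      using elim by (simp only: real_sqrt_divide) simp
    with elim have "sqrt ((?D 1 r)\<^sup>2 + (?D 2 r)\<^sup>2 / (1 - a\<^sup>2)) < 2 * r * m"
      by (simp only: pos_divide_less_eq mult_ac)
    then show ?case using elim m0 k(2) by simp
  qed
  then show ?thesis
    by (rule not_optimal_if_eventually_chord[OF a e \<tau> k(1) \<sigma>(1)])
qed

text \<open>The cusp case. The reflected geodesic arrives at the circle \<open>z = 0\<close> and the geodesic leaves it into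
the same hemisphere, both at the nonzero vertical speed \<open>\<bar>\<zeta>\<bar>\<close>. After time \<open>r\<close> the two branches are at
height of order \<open>r\<close>, while they differ in \<open>x\<close> and \<open>y\<close> by \<open>o(r\<^sup>2)\<close> only. So the length of the chord is
\<open>o(r)\<close>.\<close>

lemma not_optimal_after_equator:
  assumes a: "0 \<le> a" "a < 1" and e: "ar_extremal a {0..} \<gamma> M" and \<tau>: "0 < \<tau>" "\<tau> < t"
    and z: "\<gamma> 0 $ 3 = 0" "\<gamma> \<tau> $ 3 = 0"
  shows "\<not> ar_optimal a t \<gamma>"
proof -
  let ?D = "\<lambda>i r. \<gamma> (\<tau> + r) $ i - reflect 3 (\<gamma> (\<tau> - r)) $ i"
  let ?z = "\<lambda>s. \<gamma> s $ 3"
  have c: "1 - a\<^sup>2 > 0" using a by (simp add: abs_square_less_1)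
  have \<tau>': "\<tau> \<in> {0..}" using \<tau> by simp
  note D = extremal_component_derivs[OF e]
  \<comment> \<open>the vertical speed; a zero would make \<open>(p1, p2)\<close> orthogonal to \<open>(x, -sqrt (1 - a\<^sup>2) * y)\<close>, to which tangency of the momentum makes it parallel\<close>
  define \<zeta> where "\<zeta> = \<gamma> \<tau> $ 1 * M \<tau> $ 2 - (1 - a\<^sup>2) * \<gamma> \<tau> $ 2 * M \<tau> $ 1"
  have \<zeta>: "\<zeta> \<noteq> 0"
  proof
    assume z0: "\<zeta> = 0"
    have g: "(\<gamma> \<tau> $ 1)\<^sup>2 + (\<gamma> \<tau> $ 2)\<^sup>2 = 1"
      using ar_extremalD(3)[OF e \<tau>'] norm_vec3[of "\<gamma> \<tau>"] z by simp
    have t: "\<gamma> \<tau> $ 1 * M \<tau> $ 1 + \<gamma> \<tau> $ 2 * M \<tau> $ 2 = 0"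
      using extremal_momentum_tangent[OF e \<tau>'] z by simp
    have u: "(1 - a\<^sup>2) * (M \<tau> $ 1)\<^sup>2 + (M \<tau> $ 2)\<^sup>2 = 1"
      by (rule extremal_unit_momentum[OF e \<tau>'])
    have "\<gamma> \<tau> $ 1 * ((1 - a\<^sup>2) * (M \<tau> $ 1)\<^sup>2 + (M \<tau> $ 2)\<^sup>2) = 0"
      "\<gamma> \<tau> $ 2 * ((1 - a\<^sup>2) * (M \<tau> $ 1)\<^sup>2 + (M \<tau> $ 2)\<^sup>2) = 0"
      using z0 t unfolding \<zeta>_def by algebra+
    with u g show False by simp
  qed
  define \<sigma> where "\<sigma> = sgn \<zeta>"
  have \<sigma>: "\<bar>\<sigma>\<bar> = 1" "\<sigma> * \<zeta> = \<bar>\<zeta>\<bar>"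
    using \<zeta> by (auto simp: \<sigma>_def sgn_if)
  have dz: "(?z has_real_derivative \<zeta>) (at \<tau>)" unfolding \<zeta>_def by (rule D(3)[OF \<tau>(1)])
  have "((\<lambda>r. \<sigma> * ((?z (\<tau> + r) - ?z \<tau>) / r)) \<longlongrightarrow> \<sigma> * \<zeta>) (at_right 0)"
    by (intro tendsto_intros tendsto_difference_quotients[OF dz])
  then have e1: "\<forall>\<^sub>F r in at_right 0. \<bar>\<zeta>\<bar> / 2 < \<sigma> * ((?z (\<tau> + r) - ?z \<tau>) / r)"
    by (rule order_tendstoD) (use \<zeta> \<sigma>(2) in auto)
  have "((\<lambda>r. - \<sigma> * ((?z (\<tau> - r) - ?z \<tau>) / r)) \<longlongrightarrow> - \<sigma> * - \<zeta>) (at_right 0)"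
    by (intro tendsto_intros tendsto_difference_quotients[OF dz])
  then have e2: "\<forall>\<^sub>F r in at_right 0. \<bar>\<zeta>\<bar> / 2 < - \<sigma> * ((?z (\<tau> - r) - ?z \<tau>) / r)"
    by (rule order_tendstoD) (use \<zeta> \<sigma>(2) in auto)
  have "((\<lambda>r. ?D 1 r / r\<^sup>2) \<longlongrightarrow> 0) (at_right 0)"
    using tendsto_symmetric_second_quotient[OF D(1) DERIV_minus[OF DERIV_mult[OF D(3)[OF \<tau>(1)] D(5)[OF \<tau>(1)]]]]
      z \<tau>(1) by simp
  moreover have "((\<lambda>r. ?D 2 r / r\<^sup>2) \<longlongrightarrow> 0) (at_right 0)"
    using tendsto_symmetric_second_quotient[OF D(2) DERIV_mult[OF DERIV_cmult[OF D(3)[OF \<tau>(1)]] D(4)[OF \<tau>(1)]]]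
      z \<tau>(1) by simp
  ultimately have "((\<lambda>r. sqrt ((?D 1 r / r\<^sup>2)\<^sup>2 + (?D 2 r / r\<^sup>2)\<^sup>2 / (1 - a\<^sup>2))) \<longlongrightarrow>
      sqrt (0\<^sup>2 + 0\<^sup>2 / (1 - a\<^sup>2))) (at_right 0)"
    using c by (intro tendsto_intros) auto
  then have "\<forall>\<^sub>F r in at_right 0. sqrt ((?D 1 r / r\<^sup>2)\<^sup>2 + (?D 2 r / r\<^sup>2)\<^sup>2 / (1 - a\<^sup>2)) < \<bar>\<zeta>\<bar>"
    by (rule order_tendstoD) (use \<zeta> in simp)
  then have "\<forall>\<^sub>F r in at_right 0. 0 < \<bar>\<zeta>\<bar> / 2 * r \<and> \<bar>\<zeta>\<bar> / 2 * r \<le> \<sigma> * reflect 3 (\<gamma> (\<tau> - r)) $ 3 \<and>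
       \<bar>\<zeta>\<bar> / 2 * r \<le> \<sigma> * \<gamma> (\<tau> + r) $ 3 \<and>
       sqrt ((?D 1 r)\<^sup>2 + (?D 2 r)\<^sup>2 / (1 - a\<^sup>2)) < 2 * r * (\<bar>\<zeta>\<bar> / 2 * r)"
    using e1 e2 eventually_at_right_less[of 0]
  proof eventually_elim
    case (elim r)
    have "(?D 1 r / r\<^sup>2)\<^sup>2 + (?D 2 r / r\<^sup>2)\<^sup>2 / (1 - a\<^sup>2) = ((?D 1 r)\<^sup>2 + (?D 2 r)\<^sup>2 / (1 - a\<^sup>2)) / (r\<^sup>2)\<^sup>2"
      by (simp only: power_divide add_divide_distrib divide_divide_eq_left mult.commute)
    then have "sqrt ((?D 1 r / r\<^sup>2)\<^sup>2 + (?D 2 r / r\<^sup>2)\<^sup>2 / (1 - a\<^sup>2)) =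
        sqrt ((?D 1 r)\<^sup>2 + (?D 2 r)\<^sup>2 / (1 - a\<^sup>2)) / r\<^sup>2"
      by (simp only: real_sqrt_divide real_sqrt_abs) simp
    with elim have "sqrt ((?D 1 r)\<^sup>2 + (?D 2 r)\<^sup>2 / (1 - a\<^sup>2)) < \<bar>\<zeta>\<bar> * r\<^sup>2"
      by (simp only: pos_divide_less_eq zero_less_power)
    then have "sqrt ((?D 1 r)\<^sup>2 + (?D 2 r)\<^sup>2 / (1 - a\<^sup>2)) < 2 * r * (\<bar>\<zeta>\<bar> / 2 * r)"
      by (simp add: power2_eq_square mult_ac)
    moreover have "\<bar>\<zeta>\<bar> / 2 < \<sigma> * ?z (\<tau> + r) / r" "\<bar>\<zeta>\<bar> / 2 < \<sigma> * - ?z (\<tau> - r) / r"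
      using elim(2,3) by (simp_all add: z(2))
    then have "\<bar>\<zeta>\<bar> / 2 * r < \<sigma> * ?z (\<tau> + r)" "\<bar>\<zeta>\<bar> / 2 * r < \<sigma> * - ?z (\<tau> - r)"
      using elim(4) by (simp_all only: pos_less_divide_eq)
    ultimately show ?case using elim \<zeta> by simp
  qed
  then show ?thesis
    by (rule not_optimal_if_eventually_chord[OF a e \<tau> z(1) \<sigma>(1)])
qed

text \<open>The remaining case: the return point is \<open>\<plusminus>e1\<close> or \<open>\<plusminus>e2\<close>. There the concatenation has no corner, because
only the vertical direction is admissible, and the momenta of its two branches differ just by the sign
of their third component. By the symmetry at the pole the points to be joined are the ends of an arc
about the axis \<open>k\<close> that crosses \<open>z = 0\<close> symmetrically.\<close>

lemma not_optimal_after_pole: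
  assumes a: "0 \<le> a" "a < 1" and e: "ar_extremal a {0..} \<gamma> M" and \<tau>: "0 < \<tau>" "\<tau> < t"
    and k: "\<gamma> 0 $ k = 0" "\<gamma> \<tau> $ k = 0" "k \<noteq> 3" and z: "\<gamma> \<tau> $ 3 = 0"
    and M: "\<And>i. i \<noteq> k \<Longrightarrow> i \<noteq> 3 \<Longrightarrow> M \<tau> $ i = 0" and j: "j \<noteq> 3"
    and rot: "\<And>w. cross3 w (ar_axis a v1 v2) = w $ j *\<^sub>R axis 3 1 - w $ 3 *\<^sub>R axis j 1"
    and ev: "\<forall>\<^sub>F r in at_right 0. \<gamma> (\<tau> + r) $ j \<noteq> 0 \<and>
      \<bar>arctan (\<gamma> (\<tau> + r) $ 3 / \<gamma> (\<tau> + r) $ j)\<bar> * sqrt (v1\<^sup>2 + v2\<^sup>2) < r"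
  shows "\<not> ar_optimal a t \<gamma>"
proof -
  have "\<forall>\<^sub>F r in at_right 0. r < min \<tau> (t - \<tau>)"
    using \<tau> by (intro eventually_at_rightI[of 0 "min \<tau> (t - \<tau>)"]) auto
  from eventually_happens[OF eventually_conj[OF eventually_conj[OF ev this] eventually_at_right_less]]
  obtain r where r: "0 < r" "r < \<tau>" "\<tau> + r < t" "\<gamma> (\<tau> + r) $ j \<noteq> 0"
    "\<bar>arctan (\<gamma> (\<tau> + r) $ 3 / \<gamma> (\<tau> + r) $ j)\<bar> * sqrt (v1\<^sup>2 + v2\<^sup>2) < r"
    by auto
  obtain \<eta> where \<eta>: "\<eta> (\<tau> - r) = reflect 3 (\<gamma> (\<tau> + r))" "\<eta> (\<tau> + r) = \<gamma> (\<tau> + r)"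
    "ar_path a (\<tau> - r) (\<tau> + r)
      (2 * \<bar>arctan (\<gamma> (\<tau> + r) $ 3 / \<gamma> (\<tau> + r) $ j)\<bar> * sqrt (v1\<^sup>2 + v2\<^sup>2)) \<eta>"
    by (rule arc_path[OF _ _ r(4) j rot, of "\<tau> - r" "\<tau> + r"])
      (use r ar_extremalD(3)[OF e] in auto)
  have sym: "reflect k (\<gamma> (\<tau> - r)) = reflect 3 (\<gamma> (\<tau> + r))"
    by (rule extremal_symmetric_at_pole[OF _ _ e _ _ k(2) z M k(3)]) (use a r in auto)
  show ?thesis
  proof (rule not_optimal_if_shortcut[where r = r and \<tau> = \<tau> and k = k and \<eta> = \<eta>])
    show "ar_extremal a {0..t} \<gamma> M" by (rule ar_extremal_subset[OF e]) auto
    show "reflect k (\<gamma> 0) = \<gamma> 0" using k by (simp only: reflect_eq_self_iff)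
  qed (use a r \<eta> sym in auto)
qed

text \<open>At a corner the second momentum component is nonzero, which makes the mean velocity of the two branches
shorter than a unit vector. At the pole it vanishes, but to first order only, because its derivative is
a nonzero multiple of the third component, which cannot vanish there as well.\<close>

lemma not_optimal_after_meridian_1:
  assumes a: "0 \<le> a" "a < 1" and e: "ar_extremal a {0..} \<gamma> M" and \<tau>: "0 < \<tau>" "\<tau> < t"
    and x: "\<gamma> 0 $ 1 = 0" "\<gamma> \<tau> $ 1 = 0" and s: "0 \<le> s" "\<gamma> s $ 1 \<noteq> 0"
  shows "\<not> ar_optimal a t \<gamma>"
proof -
  define c where "c = sqrt (1 - a\<^sup>2)"
  have c: "c > 0" "c * c = 1 - a\<^sup>2"
    using a by (auto simp: c_def abs_square_less_1 abs_square_le_1)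
  have \<tau>': "\<tau> \<in> {0..}" using \<tau> by simp
  note D = extremal_component_derivs[OF e]
  have tan: "\<gamma> \<tau> $ 2 * M \<tau> $ 2 + \<gamma> \<tau> $ 3 * M \<tau> $ 3 = 0"
    using extremal_momentum_tangent[OF e \<tau>'] x by simp
  have u: "c * c * (M s $ 1)\<^sup>2 + (M s $ 2)\<^sup>2 = 1" if "0 < s" for s
    using extremal_unit_momentum[OF e, of s] that c by simp
  have "\<exists>i. i \<noteq> 1 \<and> M \<tau> $ i \<noteq> 0"
    by (rule extremal_reflected_momentum_ne[OF _ _ e _ x(2) s]) (use a \<tau> in auto)
  then have ne: "M \<tau> $ 2 \<noteq> 0 \<or> M \<tau> $ 3 \<noteq> 0"
    using exhaust_3 by metis
  show ?thesis
  proof (cases "\<gamma> \<tau> $ 3 = 0")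
    case False
    then have M2: "M \<tau> $ 2 \<noteq> 0" using tan ne by auto
    show ?thesis
    proof (rule not_optimal_if_transversal[OF a e \<tau> x(1) _ False])
      show "((\<lambda>r. (\<gamma> (\<tau> + r) $ 1 - reflect 1 (\<gamma> (\<tau> - r)) $ 1) / r) \<longlongrightarrow> 2 * 0) (at_right 0)"
        using tendsto_symmetric_quotients(2)[OF D(1)[OF \<tau>(1)] x(2)] by simp
      show "((\<lambda>r. (\<gamma> (\<tau> + r) $ 2 - reflect 1 (\<gamma> (\<tau> - r)) $ 2) / r) \<longlongrightarrow>
          2 * ((1 - a\<^sup>2) * \<gamma> \<tau> $ 3 * M \<tau> $ 1)) (at_right 0)"
        using tendsto_symmetric_quotients(1)[OF D(2)[OF \<tau>(1)]] by simp
      have "(c * c * \<gamma> \<tau> $ 3 * M \<tau> $ 1)\<^sup>2 / (c * c) = (\<gamma> \<tau> $ 3)\<^sup>2 * (c * c * (M \<tau> $ 1)\<^sup>2)"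
        using c(1) by (simp add: power2_eq_square)
      also have "c * c * (M \<tau> $ 1)\<^sup>2 = 1 - (M \<tau> $ 2)\<^sup>2"
        using u[OF \<tau>(1)] by simp
      also have "(\<gamma> \<tau> $ 3)\<^sup>2 * (1 - (M \<tau> $ 2)\<^sup>2) < (\<gamma> \<tau> $ 3)\<^sup>2"
        using False M2 by (simp add: algebra_simps)
      finally show "0\<^sup>2 + ((1 - a\<^sup>2) * \<gamma> \<tau> $ 3 * M \<tau> $ 1)\<^sup>2 / (1 - a\<^sup>2) < (\<gamma> \<tau> $ 3)\<^sup>2"
        using c(2) by simp
    qed simp
  next
    case True
    have y: "\<bar>\<gamma> \<tau> $ 2\<bar> = 1"
      using ar_extremalD(3)[OF e \<tau>'] norm_vec3[of "\<gamma> \<tau>"] x True by (auto simp: abs_square_eq_1)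
    have M2: "M \<tau> $ 2 = 0" using tan True y by auto
    then have M3: "M \<tau> $ 3 \<noteq> 0" and M1: "M \<tau> $ 1 \<noteq> 0" using ne u[OF \<tau>(1)] by auto
    have "\<forall>\<^sub>F r in at_right 0. \<gamma> (\<tau> + r) $ 2 \<noteq> 0 \<and>
        \<bar>arctan (\<gamma> (\<tau> + r) $ 3 / \<gamma> (\<tau> + r) $ 2)\<bar> < \<bar>- c\<bar> * r"
    proof (rule eventually_arctan_quotient_less[OF \<tau>(1), where \<mu> = 1 and X = "\<lambda>s. \<gamma> s $ 1" and
          P = "\<lambda>s. M s $ 2" and Q = "\<lambda>s. c * M s $ 1" and p = "(1 - a\<^sup>2) * M \<tau> $ 3 * M \<tau> $ 1"])
      show "((\<lambda>s. \<gamma> s $ 2) has_real_derivative - (- c) * (c * M s $ 1) * \<gamma> s $ 3) (at s)" if "0 < s" for s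
        using D(2)[OF that] c(2)[symmetric] by (simp add: mult_ac)
      show "((\<lambda>s. \<gamma> s $ 3) has_real_derivative - c * (c * M s $ 1) * \<gamma> s $ 2 + 1 * M s $ 2 * \<gamma> s $ 1) (at s)"
        if "0 < s" for s
        using D(3)[OF that] c(2)[symmetric] by (simp add: mult_ac)
      show "(M s $ 2)\<^sup>2 + (c * M s $ 1)\<^sup>2 = 1" if "0 < s" for s
        using u[OF that] by (simp add: power2_eq_square mult_ac)
      show "((\<lambda>s. \<gamma> s $ 1) has_real_derivative 0) (at \<tau>)"
        using D(1)[OF \<tau>(1)] True by simp
      show "((\<lambda>s. M s $ 2) has_real_derivative (1 - a\<^sup>2) * M \<tau> $ 3 * M \<tau> $ 1) (at \<tau>)"
        by (rule D(5)[OF \<tau>(1)])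
    qed (use c x y True M1 M2 M3 in auto)
    then have ev: "\<forall>\<^sub>F r in at_right 0. \<gamma> (\<tau> + r) $ 2 \<noteq> 0 \<and>
        \<bar>arctan (\<gamma> (\<tau> + r) $ 3 / \<gamma> (\<tau> + r) $ 2)\<bar> * sqrt (0\<^sup>2 + (- 1 / c)\<^sup>2) < r"
      by eventually_elim (use c(1) in \<open>simp add: real_sqrt_divide pos_divide_less_eq mult.commute\<close>)
    show ?thesis
    proof (rule not_optimal_after_pole[OF a e \<tau> x _ True _ _ _ ev])
      show "M \<tau> $ i = 0" if "i \<noteq> 1" "i \<noteq> 3" for i
        using that M2 exhaust_3 by metis
      show "cross3 w (ar_axis a 0 (- 1 / c)) = w $ 2 *\<^sub>R axis 3 1 - w $ 3 *\<^sub>R axis 2 1" for w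
        using c(1) by (simp add: vec_eq_iff forall_3 cross3_def ar_axis_def axis_def c_def[symmetric])
    qed simp_all
  qed
qed

text \<open>As in the plane \<open>x = 0\<close>, with the first two coordinates exchanged; the two frame fields have different
lengths, which changes the constants.\<close>

lemma not_optimal_after_meridian_2:
  assumes a: "0 \<le> a" "a < 1" and e: "ar_extremal a {0..} \<gamma> M" and \<tau>: "0 < \<tau>" "\<tau> < t"
    and y: "\<gamma> 0 $ 2 = 0" "\<gamma> \<tau> $ 2 = 0" and s: "0 \<le> s" "\<gamma> s $ 2 \<noteq> 0"
  shows "\<not> ar_optimal a t \<gamma>"
proof -
  define c where "c = sqrt (1 - a\<^sup>2)"
  have c: "c > 0" "c * c = 1 - a\<^sup>2"
    using a by (auto simp: c_def abs_square_less_1 abs_square_le_1)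
  have \<tau>': "\<tau> \<in> {0..}" using \<tau> by simp
  note D = extremal_component_derivs[OF e]
  have tan: "\<gamma> \<tau> $ 1 * M \<tau> $ 1 + \<gamma> \<tau> $ 3 * M \<tau> $ 3 = 0"
    using extremal_momentum_tangent[OF e \<tau>'] y by simp
  have u: "c * c * (M s $ 1)\<^sup>2 + (M s $ 2)\<^sup>2 = 1" if "0 < s" for s
    using extremal_unit_momentum[OF e, of s] that c by simp
  have "\<exists>i. i \<noteq> 2 \<and> M \<tau> $ i \<noteq> 0"
    by (rule extremal_reflected_momentum_ne[OF _ _ e _ y(2) s]) (use a \<tau> in auto)
  then have ne: "M \<tau> $ 1 \<noteq> 0 \<or> M \<tau> $ 3 \<noteq> 0"
    using exhaust_3 by metis
  show ?thesis
  proof (cases "\<gamma> \<tau> $ 3 = 0")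
    case False
    then have M1: "M \<tau> $ 1 \<noteq> 0" using tan ne by auto
    show ?thesis
    proof (rule not_optimal_if_transversal[OF a e \<tau> y(1) _ False])
      show "((\<lambda>r. (\<gamma> (\<tau> + r) $ 1 - reflect 2 (\<gamma> (\<tau> - r)) $ 1) / r) \<longlongrightarrow>
          2 * - (\<gamma> \<tau> $ 3 * M \<tau> $ 2)) (at_right 0)"
        using tendsto_symmetric_quotients(1)[OF D(1)[OF \<tau>(1)]] by simp
      show "((\<lambda>r. (\<gamma> (\<tau> + r) $ 2 - reflect 2 (\<gamma> (\<tau> - r)) $ 2) / r) \<longlongrightarrow> 2 * 0) (at_right 0)"
        using tendsto_symmetric_quotients(2)[OF D(2)[OF \<tau>(1)] y(2)] by simp
      have "(M \<tau> $ 2)\<^sup>2 = 1 - c * c * (M \<tau> $ 1)\<^sup>2"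
        using u[OF \<tau>(1)] by simp
      then have "(\<gamma> \<tau> $ 3 * M \<tau> $ 2)\<^sup>2 = (\<gamma> \<tau> $ 3)\<^sup>2 * (1 - c * c * (M \<tau> $ 1)\<^sup>2)"
        by (simp only: power_mult_distrib)
      also have "\<dots> < (\<gamma> \<tau> $ 3)\<^sup>2"
        using False M1 c(1) by (simp add: algebra_simps)
      finally show "(- (\<gamma> \<tau> $ 3 * M \<tau> $ 2))\<^sup>2 + 0\<^sup>2 / (1 - a\<^sup>2) < (\<gamma> \<tau> $ 3)\<^sup>2"
        by simp
    qed simp
  next
    case True
    have x: "\<bar>\<gamma> \<tau> $ 1\<bar> = 1"
      using ar_extremalD(3)[OF e \<tau>'] norm_vec3[of "\<gamma> \<tau>"] y True by (auto simp: abs_square_eq_1)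
    have M1: "M \<tau> $ 1 = 0" using tan True x by auto
    then have M3: "M \<tau> $ 3 \<noteq> 0" and M2: "M \<tau> $ 2 \<noteq> 0" using ne u[OF \<tau>(1)] by auto
    have "\<forall>\<^sub>F r in at_right 0. \<gamma> (\<tau> + r) $ 1 \<noteq> 0 \<and>
        \<bar>arctan (\<gamma> (\<tau> + r) $ 3 / \<gamma> (\<tau> + r) $ 1)\<bar> < \<bar>1\<bar> * r"
    proof (rule eventually_arctan_quotient_less[OF \<tau>(1), where \<mu> = "- c" and X = "\<lambda>s. \<gamma> s $ 2" and
          P = "\<lambda>s. c * M s $ 1" and Q = "\<lambda>s. M s $ 2" and p = "c * - (M \<tau> $ 3 * M \<tau> $ 2)"])
      show "((\<lambda>s. \<gamma> s $ 1) has_real_derivative - 1 * M s $ 2 * \<gamma> s $ 3) (at s)" if "0 < s" for s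
        using D(1)[OF that] by (simp add: mult_ac)
      show "((\<lambda>s. \<gamma> s $ 3) has_real_derivative 1 * M s $ 2 * \<gamma> s $ 1 + - c * (c * M s $ 1) * \<gamma> s $ 2) (at s)"
        if "0 < s" for s
        using D(3)[OF that] c(2)[symmetric] by (simp add: mult_ac)
      show "(c * M s $ 1)\<^sup>2 + (M s $ 2)\<^sup>2 = 1" if "0 < s" for s
        using u[OF that] by (simp add: power2_eq_square mult_ac)
      show "((\<lambda>s. \<gamma> s $ 2) has_real_derivative 0) (at \<tau>)"
        using D(2)[OF \<tau>(1)] True by simp
      show "((\<lambda>s. c * M s $ 1) has_real_derivative c * - (M \<tau> $ 3 * M \<tau> $ 2)) (at \<tau>)"
        by (rule DERIV_cmult[OF D(4)[OF \<tau>(1)]])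
    qed (use c x y True M1 M2 M3 in auto)
    then have ev: "\<forall>\<^sub>F r in at_right 0. \<gamma> (\<tau> + r) $ 1 \<noteq> 0 \<and>
        \<bar>arctan (\<gamma> (\<tau> + r) $ 3 / \<gamma> (\<tau> + r) $ 1)\<bar> * sqrt (1\<^sup>2 + 0\<^sup>2) < r"
      by simp
    show ?thesis
    proof (rule not_optimal_after_pole[OF a e \<tau> y _ True _ _ _ ev])
      show "M \<tau> $ i = 0" if "i \<noteq> 2" "i \<noteq> 3" for i
        using that M1 exhaust_3 by metis
      show "cross3 w (ar_axis a 1 0) = w $ 1 *\<^sub>R axis 3 1 - w $ 3 *\<^sub>R axis 1 1" for w
        by (simp add: vec_eq_iff forall_3 cross3_def ar_axis_def axis_def)
    qed simp_all
  qed
qed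

theorem theorem9:
  fixes a \<tau> :: real and \<gamma> :: "real \<Rightarrow> real^3"
  assumes "0 < a" and "a < 1"
    and "ar_geodesic a \<gamma>"
    and "0 < \<tau>"
    and "(\<gamma> 0 $ 1 = 0 \<and> \<gamma> \<tau> $ 1 = 0 \<and> (\<exists>s\<ge>0. \<gamma> s $ 1 \<noteq> 0)) \<or>
         (\<gamma> 0 $ 2 = 0 \<and> \<gamma> \<tau> $ 2 = 0 \<and> (\<exists>s\<ge>0. \<gamma> s $ 2 \<noteq> 0)) \<or>
         (\<gamma> 0 $ 3 = 0 \<and> \<gamma> \<tau> $ 3 = 0)"
  shows "\<forall>t>\<tau>. \<not> ar_optimal a t \<gamma>"
proof (intro allI impI)
  fix t assume t: "\<tau> < t"
  obtain M where e: "ar_extremal a {0..} \<gamma> M"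
    using geodesic_imp_extremal[OF assms(1-3)] .
  have a: "0 \<le> a" "a < 1" using assms by auto
  show "\<not> ar_optimal a t \<gamma>"
    using assms(5) not_optimal_after_meridian_1[OF a e assms(4) t]
      not_optimal_after_meridian_2[OF a e assms(4) t] not_optimal_after_equator[OF a e assms(4) t]
    by blast
qed

end
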